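(* In the $\alpha$-corrupted multi-user multi-armed bandit model (single context) described in the context, let the number of users be at least $L=\Omega(A\log A/\alpha)$ and the adversarial rate be $\alpha<1/3$. Consider the following procedure: divide the $L$ (good and adversarial) users randomly into $A$ groups $\mathcal I_a$, $a\in\mathcal A$; whenever a user from $\mathcal I_a$ arrives, play $a$; after $T$ total plays, compute the empirical mean of each user's rewards, and for each $a\in\mathcal A$ let $\hat\mu(a)$ be the $\alpha$-trimmed mean (in the sense of Lugosi and Mendelson, see the context) of the empirical means of the users in $\mathcal I_a$. Then after $T/L=O(\alpha/\epsilon^2)$ per-user interactions, with probability at least $9/10$, $$|\hat\mu(a)-\mu(a)|\le\epsilon\quad\text{for all } a\in\mathcal A.$$
   Context: Model (single context, $S=1$). There are $L$ users and a set $\mathcal A$ of $A$ actions (arms). For each $a\in\mathcal A$ there is a reward distribution $\mathcal R(a)$ on $\mathbb R$ with mean $\mu(a)$, $|\mu(a)|\le1$, and variance at most $1$. A set $\mathcal I^*\subseteq[L]$ of users with $|\mathcal I^*|\ge(1-\alpha)L$ is "good"; the others are "adversarial". At each step $t$ a user $i_t\in[L]$ is selected by an arrival process unknown to the learner; the learner sees $i_t$ and chooses $a_t\in\mathcal A$. If $i_t\in\mathcal I^*$ it receives $r_t\sim\mathcal R(a_t)$; if $i_t\notin\mathcal I^*$ it receives an arbitrary $r_t\in\mathbb R$, possibly depending on the whole history, on the bandit and on the algorithm (adversarial users may coordinate). The learner does not know $\mathcal I^*$ or $\mathcal R$. Only the case $\epsilon<\alpha$ is considered. Arrival assumption: with $n_i(t)$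 the number of interactions of user $i$ up to step $t$, $\max_i n_i(t)/\min_i n_i(t)\le c_L$ for all $t\ge L$, where $c_L=O(1)$ is a universal constant (absorbed into the $O,\Omega$ constants). The $\alpha$-trimmed mean is the univariate robust mean estimator of Lugosi and Mendelson (2021). Its guarantee, as used here: given an $\alpha$-corrupted set (an $\alpha$-fraction of the points is arbitrary), $\alpha<1/3$, of $\Omega(\log(1/\delta)/\alpha)$ samples from a distribution on $\mathbb R$ with mean $m$ and finite variance $\sigma^2$, it outputs $\hat m$ with $|\hat m-m|\le O(\sigma\sqrt\alpha)$ with probability at least $1-\delta$.
   Formalization: Trimming level 8α+12log(40A)/N is capped at 5/12 (the Lugosi–Mendelson estimator is undefined for larger α<1/3); log A is read as at least 1 (matters for A=1); arrivals are independent of the random division and do not react to rewards, else optional stopping biases user means. *)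

theory Defs
  imports "HOL-Probability.Probability" "HOL-Combinatorics.Combinatorics"
begin

section \<open>The Lugosi--Mendelson trimmed mean\<close>

text \<open>
  Order statistics are indexed from 1 in the literature, lists from 0; non-integral ranks
  are rounded up.
\<close>

definition order_stat :: "real list \<Rightarrow> real \<Rightarrow> real" where
  "order_stat ys q = sort ys ! (nat \<lceil>q * real (length ys)\<rceil> - 1)"

definition clip :: "real \<Rightarrow> real \<Rightarrow> real \<Rightarrow> real" where
  "clip lo hi x = max lo (min hi x)"

text \<open>
  Lugosi and Mendelson trim at level \<open>8 \<eta> + 12 ln (4 / \<delta>) / N\<close> for corruption rate \<open>\<eta>\<close> and
  confidence \<open>\<delta>\<close>. Their estimator only makes sense when this is below \<open>1 / 2\<close>, which excludes
  corruption rates above \<open>1 / 16\<close>. To cover all \<open>\<eta> < 1 / 3\<close> the level is capped at \<open>5 / 12\<close>, which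
  is still larger than \<open>\<eta>\<close>; below the cap it is exactly theirs.
\<close>

definition trim_level :: "real \<Rightarrow> real \<Rightarrow> nat \<Rightarrow> real" where
  "trim_level \<eta> \<delta> N = min (5 / 12) (8 * \<eta> + 12 * ln (4 / \<delta>) / real N)"

text \<open>
  The sample is split into two halves of size \<open>N\<close> (a possible odd last point is not used): the
  second half provides the two truncation levels, the first half is truncated and averaged.
\<close>

definition trimmed_mean :: "real \<Rightarrow> real \<Rightarrow> real list \<Rightarrow> real" where
  "trimmed_mean \<eta> \<delta> zs =
    (let N = length zs div 2;
         xs = take N zs;
         ys = take N (drop N zs);
         \<kappa> = trim_level \<eta> \<delta> N;
         lo = order_stat ys \<kappa>;
         hi = order_stat ys (1 - \<kappa>)
     in sum_list (map (clip lo hi) xs) / real N)"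


section \<open>The corrupted multi-user bandit\<close>

text \<open>
  Users are \<open>{..<L}\<close>, arms are \<open>{..<A}\<close>, steps are counted from 0. The random variable \<open>seed\<close> is the
  private randomness of the learner; \<open>user t\<close>, \<open>act t\<close> and \<open>rew t\<close> are the user who arrives, the arm
  that is played and the reward that is received at step \<open>t\<close>.
\<close>

definition visits :: "(nat \<Rightarrow> 'w \<Rightarrow> nat) \<Rightarrow> nat \<Rightarrow> nat \<Rightarrow> 'w \<Rightarrow> nat" where
  "visits user i t \<omega> = card {s. s < t \<and> user s \<omega> = i}"

definition user_mean :: "(nat \<Rightarrow> 'w \<Rightarrow> nat) \<Rightarrow> (nat \<Rightarrow> 'w \<Rightarrow> real) \<Rightarrow> nat \<Rightarrow> nat \<Rightarrow> 'w \<Rightarrow> real" where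
  "user_mean user rew i T \<omega> =
    (\<Sum>s | s < T \<and> user s \<omega> = i. rew s \<omega>) / real (visits user i T \<omega>)"

text \<open>
  The history before the reward at step \<open>t\<close>: the seed, the arrivals and the earlier rewards. Since
  the arrival process is exogenous, its whole path may be put into the history; conditioning the
  reward of a good user on it says that arrivals do not anticipate or react to rewards.
\<close>

definition history ::
  "'w measure \<Rightarrow> ('w \<Rightarrow> nat list) \<Rightarrow> (nat \<Rightarrow> 'w \<Rightarrow> nat) \<Rightarrow> (nat \<Rightarrow> 'w \<Rightarrow> real) \<Rightarrow> nat \<Rightarrow> 'w measure" where
  "history M seed user rew t =
    vimage_algebra (space M)
      (\<lambda>\<omega>. (seed \<omega>, (\<lambda>s. user s \<omega>), (\<lambda>s\<in>{..<t}. rew s \<omega>)))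
      (count_space UNIV \<Otimes>\<^sub>M (\<Pi>\<^sub>M s\<in>UNIV. count_space UNIV) \<Otimes>\<^sub>M (\<Pi>\<^sub>M s\<in>{..<t}. borel))"

text \<open>
  The arrival bound \<open>max n\<^sub>i(t) / min n\<^sub>i(t) \<le> c\<^sub>L\<close> is stated without the quotient, so that a user
  who never arrives violates it (the quotient would be \<open>0\<close> in HOL). Rewards of users
  outside \<open>good\<close> are subject to no condition besides measurability.
\<close>

locale corrupted_bandit = prob_space M
  for M :: "'w measure" +
  fixes L A :: nat
    and \<alpha> c\<^sub>L :: real
    and good :: "nat set"
    and R :: "nat \<Rightarrow> real measure"
    and \<mu> :: "nat \<Rightarrow> real"
    and seed :: "'w \<Rightarrow> nat list"
    and user act :: "nat \<Rightarrow> 'w \<Rightarrow> nat"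
    and rew :: "nat \<Rightarrow> 'w \<Rightarrow> real"
  assumes reward_prob_space: "\<And>a. a < A \<Longrightarrow> prob_space (R a)"
    and reward_sets: "\<And>a. a < A \<Longrightarrow> sets (R a) = sets borel"
    and reward_square_integrable: "\<And>a. a < A \<Longrightarrow> integrable (R a) (\<lambda>x. x\<^sup>2)"
    and reward_mean: "\<And>a. a < A \<Longrightarrow> \<mu> a = (\<integral>x. x \<partial>R a)"
    and reward_mean_bound: "\<And>a. a < A \<Longrightarrow> \<bar>\<mu> a\<bar> \<le> 1"
    and reward_variance: "\<And>a. a < A \<Longrightarrow> (\<integral>x. (x - \<mu> a)\<^sup>2 \<partial>R a) \<le> 1"
    and good_users: "good \<subseteq> {..<L}" "(1 - \<alpha>) * real L \<le> real (card good)"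
    and user_less: "\<And>t \<omega>. \<omega> \<in> space M \<Longrightarrow> user t \<omega> < L"
    and act_less: "\<And>t \<omega>. \<omega> \<in> space M \<Longrightarrow> act t \<omega> < A"
    and arrivals_balanced: "\<And>t i j \<omega>. L \<le> t \<Longrightarrow> i < L \<Longrightarrow> j < L \<Longrightarrow> \<omega> \<in> space M \<Longrightarrow>
      real (visits user i t \<omega>) \<le> c\<^sub>L * real (visits user j t \<omega>)"
    and arrivals_indep_seed:
      "indep_set (sets (vimage_algebra (space M) seed (count_space UNIV)))
        (sets (vimage_algebra (space M) (\<lambda>\<omega> s. user s \<omega>) (\<Pi>\<^sub>M s\<in>UNIV. count_space UNIV)))"
    and rew_measurable: "\<And>t. rew t \<in> borel_measurable M"
    and act_measurable: "\<And>t. act t \<in> history M seed user rew t \<rightarrow>\<^sub>M count_space UNIV"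
    and good_reward: "\<And>t B. B \<in> sets borel \<Longrightarrow>
      AE \<omega> in M. user t \<omega> \<in> good \<longrightarrow>
        real_cond_exp M (history M seed user rew t) (\<lambda>\<omega>'. indicator B (rew t \<omega>')) \<omega>
          = measure (R (act t \<omega>)) B"


section \<open>The grouping procedure\<close>

text \<open>
  The users are arranged in the order of a list \<open>p\<close> and cut into \<open>A\<close> consecutive blocks whose sizes
  differ by at most one. The groups are kept as lists: the order inside a group determines
  how the trimmed mean splits its sample.
\<close>

definition user_group :: "nat \<Rightarrow> nat \<Rightarrow> nat list \<Rightarrow> nat \<Rightarrow> nat list" where
  "user_group L A p a = drop (a * L div A) (take (Suc a * L div A) p)"

definition random_grouping ::
  "'w measure \<Rightarrow> nat \<Rightarrow> nat \<Rightarrow> ('w \<Rightarrow> nat list) \<Rightarrow> (nat \<Rightarrow> 'w \<Rightarrow> nat) \<Rightarrow> (nat \<Rightarrow> 'w \<Rightarrow> nat) \<Rightarrow> bool" where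
  "random_grouping M L A seed user act \<longleftrightarrow>
    (\<forall>\<omega>\<in>space M. seed \<omega> \<in> permutations_of_set {..<L}) \<and>
    distr M (count_space UNIV) seed = measure_pmf (pmf_of_set (permutations_of_set {..<L})) \<and>
    (\<forall>\<omega>\<in>space M. \<forall>t. \<forall>a<A. user t \<omega> \<in> set (user_group L A (seed \<omega>) a) \<longrightarrow> act t \<omega> = a)"

text \<open>The confidence parameter is \<open>1 / (10 A)\<close>, for a union bound over the arms.\<close>

definition arm_estimate ::
  "nat \<Rightarrow> nat \<Rightarrow> real \<Rightarrow> ('w \<Rightarrow> nat list) \<Rightarrow> (nat \<Rightarrow> 'w \<Rightarrow> nat) \<Rightarrow> (nat \<Rightarrow> 'w \<Rightarrow> real) \<Rightarrow>
    nat \<Rightarrow> nat \<Rightarrow> 'w \<Rightarrow> real" where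
  "arm_estimate L A \<alpha> seed user rew T a \<omega> =
    trimmed_mean \<alpha> (1 / (10 * real A))
      (map (\<lambda>i. user_mean user rew i T \<omega>) (user_group L A (seed \<omega>) a))"

text \<open>
  A sample space on which every joint law of seed, arrivals and rewards can be realised. Using one
  type for all instances lets the constants of an asymptotic statement be universal, which a free
  type variable would not.
\<close>

type_synonym run = "nat list \<times> (nat \<Rightarrow> nat) \<times> (nat \<Rightarrow> real)"

end

theory Submission
  imports Defs
begin

text \<open>
  Fix the arrival path of the first \<open>T\<close> steps. Given the path and the seed, the rewards of the good users
  of a group are independent draws from the law of its arm, whatever the adversarial users do, so the
  empirical means of these users are independent, with a law that does not depend on the seed, mean \<open>\<mu> a\<close>
  and variance at most \<open>v = O(L / T)\<close>. Averaging over the seed, users are sampled without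
  replacement, and for nonnegative functions \<open>g\<close> of the user the mean of \<open>\<Prod> g\<close> over a block is at most the
  corresponding power of the mean of \<open>g\<close> (Maclaurin's inequality). So exponential moments behave as for
  independent draws from the mixture of all users.

  With \<open>s\<^sup>2 \<kappa> = 10 v\<close>, this yields that fewer than \<open>\<kappa> N\<close> points of each half are corrupted or further than \<open>s\<close>
  from \<open>\<mu> a\<close>, so both truncation levels lie within \<open>s\<close> of \<open>\<mu> a\<close>. A quantile of the mixture at
  level \<open>3 \<kappa> / 2\<close> separates the lower truncation level, computed from the second half, from all but
  \<open>3 \<kappa> N\<close> good points of the first half, and similarly above; hence replacing the empirical truncation
  levels by \<open>\<mu> a \<plusminus> s\<close> changes few summands, each by at most \<open>2 s\<close>. The total error is \<open>O(s \<kappa>) = O(sqrt (v \<kappa>))\<close>,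
  which is at most \<open>\<epsilon>\<close> as \<open>\<kappa> \<le> 9 \<alpha>\<close>. Only counts of this kind enter, so the adversarial rewards may depend
  on the good ones.
\<close>

section \<open>Sampling without replacement\<close>

text \<open>
  The right-hand side is the tangent at \<open>u = 0\<close>. Below, \<open>1 + u\<close> is a value of \<open>g\<close> divided by its mean, so
  the linear terms cancel when summed over all users.
\<close>

lemma mult_power_le_tangent:
  fixes u l :: real
  assumes "u \<le> l" "0 < l" "real n \<le> l"
  shows "(1 + u) * (1 - u / l) ^ n \<le> 1 + u * (1 - real n / l)"
  using assms(3)
proof (induction n)
  case (Suc n)
  have p: "0 \<le> 1 - u / l" "0 \<le> 1 - real n / l"
    using assms Suc.prems by (auto simp: divide_simps)
  have "(1 + u) * (1 - u / l) ^ Suc n = ((1 + u) * (1 - u / l) ^ n) * (1 - u / l)"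
    by simp
  also have "\<dots> \<le> (1 + u * (1 - real n / l)) * (1 - u / l)"
    using Suc p by (intro mult_right_mono) auto
  also have "\<dots> = 1 + u * (1 - real (Suc n) / l) - u\<^sup>2 / l * (1 - real n / l)"
    using assms(2) by (simp add: field_simps power2_eq_square)
  also have "\<dots> \<le> 1 + u * (1 - real (Suc n) / l)"
    using p(2) assms(2) by simp
  finally show ?case .
qed simp

text \<open>Split off the first entry \<open>x\<close>: the rest is a permutation of
  \<open>S - {x}\<close>, on which \<open>g\<close> has mean \<open>(G - g x) / l\<close>, so
  induction on \<open>N\<close> leaves the sum of \<open>g x * ((G - g x) / l) ^ N\<close> over
  \<open>x\<close>. With \<open>u = g x / m - 1\<close> the tangent inequality bounds each term by
  an affine function of \<open>g x\<close>, and these bounds add up to the value for constant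
  \<open>g\<close>.\<close>

lemma sum_permutations_prod_le:
  fixes g :: "'a \<Rightarrow> real"
  assumes "finite S" "\<And>i. i \<in> S \<Longrightarrow> 0 \<le> g i" "N \<le> card S"
  shows "(\<Sum>p\<in>permutations_of_set S. \<Prod>k<N. g (p ! k)) \<le> fact (card S) * ((\<Sum>i\<in>S. g i) / card S) ^ N"
  using assms
proof (induction N arbitrary: S)
  case (Suc N)
  then have ne: "S \<noteq> {}" by auto
  define l where "l = card S - 1"
  define G where "G = (\<Sum>i\<in>S. g i)"
  define m where "m = G / real (card S)"
  have cS: "card S = Suc l" using Suc.prems ne by (simp add: l_def card_gt_0_iff)
  have Nl: "N \<le> l" using Suc.prems cS by simp
  have m0: "0 \<le> m" using Suc.prems by (auto simp: m_def G_def intro!: divide_nonneg_nonneg sum_nonneg)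
  have rest: "(\<Sum>i\<in>S - {x}. g i) = G - g x" if "x \<in> S" for x
    using that Suc.prems by (simp add: G_def sum_diff1)
  have "(\<Sum>p\<in>permutations_of_set S. \<Prod>k<Suc N. g (p ! k))
      = (\<Sum>x\<in>S. \<Sum>p\<in>(#) x ` permutations_of_set (S - {x}). \<Prod>k<Suc N. g (p ! k))"
    unfolding permutations_of_set_nonempty[OF ne]
    using Suc.prems by (intro sum.UNION_disjoint) auto
  also have "\<dots> = (\<Sum>x\<in>S. g x * (\<Sum>p\<in>permutations_of_set (S - {x}). \<Prod>k<N. g (p ! k)))"
    by (intro sum.cong refl, subst sum.reindex)
       (auto simp: prod.lessThan_Suc_shift sum_distrib_left simp del: prod.lessThan_Suc)
  also have "\<dots> \<le> (\<Sum>x\<in>S. g x * (fact l * ((G - g x) / l) ^ N))"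
  proof (intro sum_mono mult_left_mono)
    fix x assume x: "x \<in> S"
    show "(\<Sum>p\<in>permutations_of_set (S - {x}). \<Prod>k<N. g (p ! k)) \<le> fact l * ((G - g x) / l) ^ N"
      using Suc.IH[of "S - {x}"] Suc.prems x cS Nl rest[OF x] by simp
  qed (use Suc.prems in auto)
  also have "\<dots> = fact l * (\<Sum>x\<in>S. g x * ((G - g x) / l) ^ N)"
    by (simp add: sum_distrib_left mult_ac)
  also have "(\<Sum>x\<in>S. g x * ((G - g x) / l) ^ N) \<le> real (Suc l) * m ^ Suc N"
  \<comment> \<open>The tangent argument divides by \<open>m\<close> and by \<open>l\<close>. If
    \<open>m = 0\<close>, then \<open>g\<close> vanishes on \<open>S\<close>; if
    \<open>N = 0\<close>, only the sum of \<open>g\<close> is left; otherwise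
    \<open>N \<le> l\<close> makes \<open>l\<close> positive.\<close>
  proof (cases "m = 0 \<or> N = 0")
    case True
    moreover have "g x = 0" if "m = 0" "x \<in> S" for x
      using that Suc.prems ne by (auto simp: m_def G_def sum_nonneg_eq_0_iff)
    moreover have "G = real (Suc l) * m" by (simp add: m_def cS del: of_nat_Suc)
    ultimately show ?thesis by (auto simp flip: G_def)
  next
    case False
    then have m: "0 < m" and l: "0 < real l" using m0 Nl by auto
    have G: "G = (1 + real l) * m" by (simp add: m_def cS)
    have "(\<Sum>x\<in>S. g x * ((G - g x) / l) ^ N) \<le> (\<Sum>x\<in>S. m ^ Suc N * (1 + (g x / m - 1) * (1 - real N / l)))"
    proof (intro sum_mono)
      fix x assume x: "x \<in> S"
      \<comment> \<open>No single value exceeds the total \<open>(1 + l) * m\<close>; this is the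
        condition \<open>u \<le> l\<close> of the tangent inequality.\<close>
      have "g x \<le> G" unfolding G_def using x Suc.prems by (intro member_le_sum) auto
      then have u: "g x / m - 1 \<le> l" using m by (simp add: G field_simps)
      have e: "(G - g x) / l = m * (1 - (g x / m - 1) / l)"
        using m l by (simp add: G field_simps)
      have "g x * ((G - g x) / l) ^ N = m ^ Suc N * ((1 + (g x / m - 1)) * (1 - (g x / m - 1) / l) ^ N)"
        using m by (simp add: e power_mult_distrib)
      also have "\<dots> \<le> m ^ Suc N * (1 + (g x / m - 1) * (1 - real N / l))"
        using m Nl by (intro mult_left_mono mult_power_le_tangent[OF u l]) auto
      finally show "g x * ((G - g x) / l) ^ N \<le> m ^ Suc N * (1 + (g x / m - 1) * (1 - real N / l))" .
    qed
    also have "\<dots> = m ^ Suc N * (real (card S) + (G / m - real (card S)) * (1 - real N / l))"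
      by (simp add: sum_distrib_left[symmetric] sum.distrib sum_distrib_right[symmetric] sum_subtractf
          sum_divide_distrib[symmetric] G_def)
    also have "G / m = real (card S)" using m by (simp add: G cS)
    finally show ?thesis by (simp add: cS mult_ac)
  qed
  finally show ?case by (simp add: cS m_def G_def mult_ac)
qed simp

text \<open>Rotation by \<open>s\<close> maps the set of orderings bijectively to itself and brings
  the block that starts at \<open>s\<close> to the front, so every block behaves like the first
  one.\<close>

lemma sum_permutations_prod_block_le:
  fixes g :: "'a \<Rightarrow> real"
  assumes "finite S" "\<And>i. i \<in> S \<Longrightarrow> 0 \<le> g i" "s + N \<le> card S"
  shows "(\<Sum>p\<in>permutations_of_set S. \<Prod>k\<in>{s..<s + N}. g (p ! k))
    \<le> fact (card S) * ((\<Sum>i\<in>S. g i) / card S) ^ N"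
proof -
  have bij: "bij_betw (rotate s) (permutations_of_set S) (permutations_of_set S)"
  proof (rule bij_betw_imageI)
    show inj: "inj_on (rotate s) (permutations_of_set S)"
      using inj_fn[OF inj_rotate1] by (auto simp: rotate_def intro: inj_on_subset)
    have "rotate s ` permutations_of_set S \<subseteq> permutations_of_set S"
      by (auto simp: permutations_of_set_def)
    then show "rotate s ` permutations_of_set S = permutations_of_set S"
      using inj assms(1) by (intro endo_inj_surj) auto
  qed
  have "(\<Prod>k\<in>{s..<s + N}. g (p ! k)) = (\<Prod>k<N. g (rotate s p ! k))" if "p \<in> permutations_of_set S" for p
  proof -
    have "length p = card S" using that by (rule length_finite_permutations_of_set)
    then have "(\<Prod>k<N. g (rotate s p ! k)) = (\<Prod>k<N. g (p ! (s + k)))"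
      using assms(3) by (intro prod.cong refl) (auto simp: nth_rotate)
    also have "\<dots> = (\<Prod>k\<in>{s..<s + N}. g (p ! k))"
      by (rule prod.reindex_bij_witness[of _ "\<lambda>k. k - s" "\<lambda>k. s + k"]) auto
    finally show ?thesis ..
  qed
  then have "(\<Sum>p\<in>permutations_of_set S. \<Prod>k\<in>{s..<s + N}. g (p ! k))
      = (\<Sum>p\<in>permutations_of_set S. \<Prod>k<N. g (rotate s p ! k))"
    by simp
  also have "\<dots> = (\<Sum>p\<in>permutations_of_set S. \<Prod>k<N. g (p ! k))"
    by (rule sum.reindex_bij_betw[OF bij])
  finally show ?thesis using sum_permutations_prod_le[OF assms(1,2), where N=N] assms(3) by simp
qed

section \<open>The trimmed mean\<close>

text \<open>A downward closed predicate holds on an initial segment of the sorted list, so it holds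
  at index \<open>j\<close> exactly when more than \<open>j\<close> entries satisfy it. This turns
  order statistics into counts.\<close>

lemma sort_nth_le_iff:
  fixes ys :: "real list"
  assumes "j < length ys"
  shows "sort ys ! j \<le> x \<longleftrightarrow> j < length (filter (\<lambda>y. y \<le> x) ys)"
    and "sort ys ! j < x \<longleftrightarrow> j < length (filter (\<lambda>y. y < x) ys)"
proof -
  have len: "length (filter P ys) = card {i. i < length ys \<and> P (sort ys ! i)}" for P
  proof -
    have "length (filter P ys) = length (filter P (sort ys))"
      by (metis filter_sort length_sort)
    then show ?thesis by (simp add: length_filter_conv_card)
  qed
  have mono: "sort ys ! i \<le> sort ys ! k" if "i \<le> k" "k < length ys" for i k
    using that by (intro sorted_nth_mono) auto
  have gen: "P (sort ys ! j) \<longleftrightarrow> j < length (filter P ys)"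
    if down: "\<And>y z. P y \<Longrightarrow> z \<le> y \<Longrightarrow> P z" for P
  proof
    assume "P (sort ys ! j)"
    then have "{..j} \<subseteq> {i. i < length ys \<and> P (sort ys ! i)}"
      using assms by (auto intro: down mono)
    from card_mono[OF _ this] show "j < length (filter P ys)" by (simp add: len)
  next
    assume *: "j < length (filter P ys)"
    show "P (sort ys ! j)"
    proof (rule ccontr)
      assume n: "\<not> P (sort ys ! j)"
      have "{i. i < length ys \<and> P (sort ys ! i)} \<subseteq> {..<j}"
      proof (intro subsetI, elim CollectE conjE)
        fix i assume i: "i < length ys" "P (sort ys ! i)"
        show "i \<in> {..<j}"
        proof (rule ccontr)
          assume "i \<notin> {..<j}"
          then have "sort ys ! j \<le> sort ys ! i" using i by (intro mono) auto
          with n i show False using down by blast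
        qed
      qed
      from card_mono[OF _ this] * show False by (simp add: len)
    qed
  qed
  show "sort ys ! j \<le> x \<longleftrightarrow> j < length (filter (\<lambda>y. y \<le> x) ys)"
    and "sort ys ! j < x \<longleftrightarrow> j < length (filter (\<lambda>y. y < x) ys)"
    by (rule gen; simp)+
qed

lemma order_stat_bounds:
  fixes q x :: real
  assumes "0 < q" "q \<le> 1" "ys \<noteq> []"
  shows "q * length ys \<le> length (filter (\<lambda>y. y \<le> x) ys) \<Longrightarrow> order_stat ys q \<le> x"
    and "length (filter (\<lambda>y. y < x) ys) < q * length ys \<Longrightarrow> x \<le> order_stat ys q"
proof -
  define j where "j = nat \<lceil>q * real (length ys)\<rceil> - 1"
  have pos: "0 < q * real (length ys)" using assms by simp
  have le: "q * real (length ys) \<le> real (length ys)" using assms by (simp add: mult_left_le_one_le)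
  \<comment> \<open>Since \<open>q > 0\<close>, the ceiling is at least 1 and the subtraction on
    \<open>nat\<close> in the index is exact.\<close>
  have j1: "real j + 1 = of_int \<lceil>q * real (length ys)\<rceil>"
    using pos by (simp add: j_def of_nat_diff Suc_leI)
  then have j: "real j < q * length ys" "q * length ys \<le> real j + 1" by linarith+
  then have jl: "j < length ys" using le by linarith
  show "order_stat ys q \<le> x" if "q * length ys \<le> length (filter (\<lambda>y. y \<le> x) ys)"
    unfolding order_stat_def j_def[symmetric] sort_nth_le_iff(1)[OF jl] using that j by linarith
  show "x \<le> order_stat ys q" if "length (filter (\<lambda>y. y < x) ys) < q * length ys"
  proof -
    have "\<not> order_stat ys q < x"
      unfolding order_stat_def j_def[symmetric] sort_nth_le_iff(2)[OF jl] using that j by linarith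
    then show ?thesis by simp
  qed
qed

lemma length_filter_segment:
  assumes "s + N \<le> length zs"
  shows "length (filter P (take N (drop s zs))) = card {k\<in>{s..<s + N}. P (zs ! k)}"
proof -
  have "length (filter P (take N (drop s zs))) = card {i. i < N \<and> P (zs ! (s + i))}"
    using assms by (auto simp: length_filter_conv_card intro!: arg_cong[where f=card])
  also have "\<dots> = card ((+) s ` {i. i < N \<and> P (zs ! (s + i))})"
    by (subst card_image) auto
  also have "(+) s ` {i. i < N \<and> P (zs ! (s + i))} = {k\<in>{s..<s + N}. P (zs ! k)}"
  proof (intro equalityI subsetI)
    fix k assume "k \<in> {k\<in>{s..<s + N}. P (zs ! k)}"
    then show "k \<in> (+) s ` {i. i < N \<and> P (zs ! (s + i))}" by (intro image_eqI[of _ _ "k - s"]) auto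
  qed auto
  finally show ?thesis .
qed

lemma sum_list_segment:
  assumes "s + N \<le> length zs"
  shows "sum_list (map f (take N (drop s zs))) = (\<Sum>k\<in>{s..<s + N}. f (zs ! k))"
proof -
  have "sum_list (map f (take N (drop s zs))) = (\<Sum>i<N. f (zs ! (s + i)))"
    using assms by (simp add: sum_list_sum_nth atLeast0LessThan)
  also have "\<dots> = (\<Sum>k\<in>{s..<s + N}. f (zs ! k))"
    by (rule sum.reindex_bij_witness[of _ "\<lambda>k. k - s" "\<lambda>k. s + k"]) auto
  finally show ?thesis .
qed

text \<open>The last two bounds count the points above \<open>x\<close> and follow from the first
  two by complement: at level \<open>1 - \<kappa>\<close> the tail to be controlled is the upper
  one, of share \<open>\<kappa>\<close>.\<close>

lemma order_stat_segment_bounds: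
  fixes q x :: real
  assumes "0 < q" "q \<le> 1" "0 < N" "s + N \<le> length zs"
  shows "q * N \<le> card {k\<in>{s..<s + N}. zs ! k \<le> x} \<Longrightarrow> order_stat (take N (drop s zs)) q \<le> x"
    and "card {k\<in>{s..<s + N}. zs ! k < x} < q * N \<Longrightarrow> x \<le> order_stat (take N (drop s zs)) q"
    and "card {k\<in>{s..<s + N}. x < zs ! k} \<le> (1 - q) * N \<Longrightarrow> order_stat (take N (drop s zs)) q \<le> x"
    and "(1 - q) * N < card {k\<in>{s..<s + N}. x \<le> zs ! k} \<Longrightarrow> x \<le> order_stat (take N (drop s zs)) q"
proof -
  have len: "length (take N (drop s zs)) = N" and ne: "take N (drop s zs) \<noteq> []" using assms by auto
  note * = order_stat_bounds[OF assms(1,2) ne, of x, unfolded len length_filter_segment[OF assms(4)]]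
  have split: "real (card {k\<in>{s..<s + N}. P k}) + real (card {k\<in>{s..<s + N}. \<not> P k}) = real N" for P
  proof -
    have "card ({k\<in>{s..<s + N}. P k} \<union> {k\<in>{s..<s + N}. \<not> P k})
        = card {k\<in>{s..<s + N}. P k} + card {k\<in>{s..<s + N}. \<not> P k}"
      by (rule card_Un_disjoint) auto
    moreover have "{k\<in>{s..<s + N}. P k} \<union> {k\<in>{s..<s + N}. \<not> P k} = {s..<s + N}" by auto
    ultimately show ?thesis by simp
  qed
  show "q * N \<le> card {k\<in>{s..<s + N}. zs ! k \<le> x} \<Longrightarrow> order_stat (take N (drop s zs)) q \<le> x"
    and "card {k\<in>{s..<s + N}. zs ! k < x} < q * N \<Longrightarrow> x \<le> order_stat (take N (drop s zs)) q"
    using * by auto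
  show "card {k\<in>{s..<s + N}. x < zs ! k} \<le> (1 - q) * N \<Longrightarrow> order_stat (take N (drop s zs)) q \<le> x"
    using *(1) split[of "\<lambda>k. zs ! k \<le> x"] by (simp add: not_le algebra_simps)
  show "(1 - q) * N < card {k\<in>{s..<s + N}. x \<le> zs ! k} \<Longrightarrow> x \<le> order_stat (take N (drop s zs)) q"
    using *(2) split[of "\<lambda>k. zs ! k < x"] by (simp add: not_less algebra_simps)
qed

text \<open>The deterministic part of the argument: \<open>bad\<close> marks adversarial positions,
  and \<open>q1\<close>, \<open>q2\<close> are cut points. The counts on the second half place
  \<open>lo\<close> between \<open>m - s\<close> and \<open>q1\<close>, and \<open>hi\<close>
  between \<open>q2\<close> and \<open>m + s\<close>. A good point of the first half that is neither
  below \<open>q1\<close> nor above \<open>q2\<close> is then changed neither by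
  \<open>clip lo hi\<close> nor by truncation at \<open>m \<plusminus> s\<close>, so the two
  truncated sums differ only at the adversarial points and at the good points beyond a cut
  point.\<close>

lemma trimmed_mean_deviation:
  fixes zs :: "real list" and bad :: "nat \<Rightarrow> bool" and m s \<kappa> \<eta> \<delta> q1 q2 :: real
  defines "N \<equiv> length zs div 2"
  assumes \<kappa>: "\<kappa> = trim_level \<eta> \<delta> N" "0 < \<kappa>" and N: "0 < N" and s: "0 < s"
    and "card {k\<in>{N..<N + N}. bad k \<or> s < \<bar>zs ! k - m\<bar>} < \<kappa> * N"
    and bad1: "card {k\<in>{0..<N}. bad k \<or> s < \<bar>zs ! k - m\<bar>} < \<kappa> * N"
    and centre: "\<bar>\<Sum>k\<in>{0..<N}. if bad k then 0 else clip (- s) s (zs ! k - m)\<bar> \<le> s * \<kappa> * N"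
    and "\<kappa> * N < card {k\<in>{N..<N + N}. \<not> bad k \<and> zs ! k \<le> q1}"
    and q1: "card {k\<in>{0..<N}. \<not> bad k \<and> zs ! k < q1} \<le> 3 * \<kappa> * N"
    and "\<kappa> * N < card {k\<in>{N..<N + N}. \<not> bad k \<and> q2 \<le> zs ! k}"
    and q2: "card {k\<in>{0..<N}. \<not> bad k \<and> q2 < zs ! k} \<le> 3 * \<kappa> * N"
  shows "\<bar>trimmed_mean \<eta> \<delta> zs - m\<bar> \<le> 14 * s * \<kappa>"
proof -
  define ys where "ys = take N (drop N zs)"
  define lo hi where "lo = order_stat ys \<kappa>" and "hi = order_stat ys (1 - \<kappa>)"
  have k12: "\<kappa> \<le> 5 / 12" unfolding \<kappa>(1) trim_level_def by (rule min.cobounded1)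
  have len: "N + N \<le> length zs" "0 + N \<le> length zs" by (auto simp: N_def)
  have less: "card {k\<in>{N..<N + N}. P k} < \<kappa> * N"
    if "\<And>k. P k \<Longrightarrow> bad k \<or> s < \<bar>zs ! k - m\<bar>" for P
    using assms(6) that card_mono[of "{k\<in>{N..<N + N}. bad k \<or> s < \<bar>zs ! k - m\<bar>}" "{k\<in>{N..<N + N}. P k}"]
    by force
  have more: "\<kappa> * N < card {k\<in>{N..<N + N}. P k}"
    if "\<kappa> * N < card {k\<in>{N..<N + N}. Q k}" "\<And>k. Q k \<Longrightarrow> P k" for P Q
    using that card_mono[of "{k\<in>{N..<N + N}. P k}" "{k\<in>{N..<N + N}. Q k}"] by force
  note b = order_stat_segment_bounds[OF _ _ N len(1), folded ys_def]
  have k01: "0 < 1 - \<kappa>" "1 - \<kappa> \<le> 1" "\<kappa> \<le> 1" using \<kappa>(2) k12 by auto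
  have outer: "card {k\<in>{N..<N + N}. zs ! k < m - s} < \<kappa> * N" "card {k\<in>{N..<N + N}. m + s < zs ! k} < \<kappa> * N"
    by (rule less; linarith)+
  have lo: "m - s \<le> lo" "lo \<le> q1"
    using b(2)[OF \<kappa>(2) k01(3), where x="m - s"] outer(1)
      b(1)[OF \<kappa>(2) k01(3), where x=q1] more[OF assms(9), of "\<lambda>k. zs ! k \<le> q1"]
    by (auto simp: lo_def)
  have hi: "hi \<le> m + s" "q2 \<le> hi"
    using b(3)[OF k01(1,2), where x="m + s"] outer(2)
      b(4)[OF k01(1,2), where x=q2] more[OF assms(11), of "\<lambda>k. q2 \<le> zs ! k"]
    by (auto simp: hi_def)
  \<comment> \<open>The cap \<open>5 / 12\<close> keeps \<open>\<kappa>\<close> below one half, so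
    the lower rank does not exceed the upper one. Consequently both levels lie within
    \<open>s\<close> of \<open>m\<close>.\<close>
  have "lo \<le> hi" unfolding lo_def hi_def order_stat_def
  proof (intro sorted_nth_mono)
    have "\<kappa> * real (length ys) \<le> (1 - \<kappa>) * real (length ys)"
      using k12 by (intro mult_right_mono) auto
    then show "nat \<lceil>\<kappa> * real (length ys)\<rceil> - 1 \<le> nat \<lceil>(1 - \<kappa>) * real (length ys)\<rceil> - 1"
      by (intro diff_le_mono nat_mono ceiling_mono)
    have "0 < length ys" using N by (simp add: ys_def N_def)
    moreover have "(1 - \<kappa>) * real (length ys) \<le> real (length ys)"
      using \<kappa>(2) by (simp add: algebra_simps)
    then have "nat \<lceil>(1 - \<kappa>) * real (length ys)\<rceil> \<le> length ys"
      by (simp add: ceiling_le_iff)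
    ultimately show "nat \<lceil>(1 - \<kappa>) * real (length ys)\<rceil> - 1 < length (sort ys)" unfolding length_sort by linarith
  qed simp
  then have lohi: "lo \<le> m + s" "m - s \<le> hi" using lo hi by linarith+
  have clip_in: "\<bar>clip lo hi x - m\<bar> \<le> s" for x
    using lo hi lohi by (auto simp: clip_def max_def min_def abs_le_iff)
  have est: "trimmed_mean \<eta> \<delta> zs = (\<Sum>k\<in>{0..<N}. clip lo hi (zs ! k)) / N"
    using sum_list_segment[OF len(2), of "clip lo hi"]
    by (simp add: trimmed_mean_def Let_def N_def[symmetric] \<kappa>(1)[symmetric] lo_def hi_def ys_def)
  define ind :: "(nat \<Rightarrow> bool) \<Rightarrow> nat \<Rightarrow> real" where "ind P k = (if P k then 1 else 0)" for P k
  have sum_ind: "(\<Sum>k\<in>{0..<N}. ind P k) = card {k\<in>{0..<N}. P k}" for P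
    by (simp add: ind_def sum.If_cases Int_def)
  have term_le: "\<bar>clip lo hi (zs ! k) - m - (if bad k then 0 else clip (- s) s (zs ! k - m))\<bar>
      \<le> s * ind (\<lambda>k. bad k \<or> s < \<bar>zs ! k - m\<bar>) k
        + 2 * s * ind (\<lambda>k. \<not> bad k \<and> zs ! k < q1) k + 2 * s * ind (\<lambda>k. \<not> bad k \<and> q2 < zs ! k) k" for k
  proof (cases "bad k")
    case True
    then show ?thesis using clip_in[of "zs ! k"] by (simp add: ind_def)
  next
    case False
    have c: "\<bar>clip (- s) s (zs ! k - m)\<bar> \<le> s" using s by (auto simp: clip_def)
    show ?thesis
    proof (cases "zs ! k < q1 \<or> q2 < zs ! k")
      case True
      have "\<bar>clip lo hi (zs ! k) - m - clip (- s) s (zs ! k - m)\<bar> \<le> 2 * s"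
        using c clip_in[of "zs ! k"] by linarith
      moreover have "0 \<le> s * ind (\<lambda>k. bad k \<or> s < \<bar>zs ! k - m\<bar>) k" using s by (simp add: ind_def)
      ultimately show ?thesis using False True s by (auto simp: ind_def)
    next
      case inside: False
      then have "lo \<le> zs ! k" "zs ! k \<le> hi" using lo hi by linarith+
      then have "clip lo hi (zs ! k) = zs ! k" "clip (- s) s (zs ! k - m) = zs ! k - m"
        using lo hi by (auto simp: clip_def)
      then show ?thesis using False s by (simp add: ind_def)
    qed
  qed
  have "N * \<bar>trimmed_mean \<eta> \<delta> zs - m\<bar> = \<bar>\<Sum>k\<in>{0..<N}. clip lo hi (zs ! k) - m\<bar>"
    using N by (simp add: est sum_subtractf abs_mult[of "real N", simplified, symmetric] algebra_simps del: abs_mult)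
  also have "\<dots> \<le> \<bar>\<Sum>k\<in>{0..<N}. clip lo hi (zs ! k) - m - (if bad k then 0 else clip (- s) s (zs ! k - m))\<bar>
      + \<bar>\<Sum>k\<in>{0..<N}. if bad k then 0 else clip (- s) s (zs ! k - m)\<bar>"
    by (simp only: sum_subtractf[of _ "\<lambda>k. if bad k then 0 else clip (- s) s (zs ! k - m)"])
  also have "\<bar>\<Sum>k\<in>{0..<N}. clip lo hi (zs ! k) - m - (if bad k then 0 else clip (- s) s (zs ! k - m))\<bar>
      \<le> (\<Sum>k\<in>{0..<N}. s * ind (\<lambda>k. bad k \<or> s < \<bar>zs ! k - m\<bar>) k
        + 2 * s * ind (\<lambda>k. \<not> bad k \<and> zs ! k < q1) k + 2 * s * ind (\<lambda>k. \<not> bad k \<and> q2 < zs ! k) k)"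
    by (intro order_trans[OF sum_abs] sum_mono term_le)
  also have "\<dots> = s * card {k\<in>{0..<N}. bad k \<or> s < \<bar>zs ! k - m\<bar>}
      + 2 * s * card {k\<in>{0..<N}. \<not> bad k \<and> zs ! k < q1} + 2 * s * card {k\<in>{0..<N}. \<not> bad k \<and> q2 < zs ! k}"
    by (simp only: sum.distrib sum_distrib_left[symmetric] sum_ind)
  \<comment> \<open>An adversarial point costs at most \<open>s\<close> and a good point beyond a
    cut point at most \<open>2 * s\<close>. This gives \<open>1 + 6 + 6 = 13\<close> multiples of
    \<open>s * \<kappa> * N\<close>, and \<open>centre\<close> supplies the fourteenth.\<close>
  also have "\<dots> \<le> s * (\<kappa> * N) + 2 * s * (3 * \<kappa> * N) + 2 * s * (3 * \<kappa> * N)"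
    using bad1 q1 q2 s by (intro add_mono mult_left_mono) auto
  finally have "N * \<bar>trimmed_mean \<eta> \<delta> zs - m\<bar> \<le> N * (14 * s * \<kappa>)"
    using centre by (simp add: algebra_simps)
  then show ?thesis using N by simp
qed

section \<open>Quantiles and laws of sample means\<close>

text \<open>The sum of the distribution functions is nondecreasing and right-continuous with limits
  0 and \<open>card J\<close>, and \<open>q\<close> is its generalised inverse at
  \<open>\<rho>\<close>. Atoms may make it jump over \<open>\<rho>\<close>, hence one bound for
  \<open>{..<q}\<close> and one for \<open>{..q}\<close>. A family of laws is needed because users
  differ in their numbers of visits.\<close>

lemma exists_common_quantile:
  fixes \<nu> :: "'i \<Rightarrow> real measure" and \<rho> :: real
  assumes "finite J" "\<And>i. i \<in> J \<Longrightarrow> real_distribution (\<nu> i)" "0 < \<rho>" "\<rho> < card J"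
  shows "\<exists>q. (\<Sum>i\<in>J. measure (\<nu> i) {..<q}) \<le> \<rho> \<and> \<rho> \<le> (\<Sum>i\<in>J. measure (\<nu> i) {..q})"
proof -
  define F where "F x = (\<Sum>i\<in>J. cdf (\<nu> i) x)" for x
  have fbm: "finite_borel_measure (\<nu> i)" if "i \<in> J" for i
    using assms(2)[OF that] by (rule real_distribution.finite_borel_measure_M)
  have mono: "F x \<le> F y" if "x \<le> y" for x y
    unfolding F_def using that by (intro sum_mono finite_borel_measure.cdf_nondecreasing fbm)
  have "(F \<longlongrightarrow> (\<Sum>i\<in>J. 1)) at_top"
    unfolding F_def using assms(2) by (intro tendsto_sum real_distribution.cdf_lim_at_top_prob)
  then have "eventually (\<lambda>x. \<rho> < F x) at_top" using assms(4) by (intro order_tendstoD) auto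
  then obtain b where b: "\<rho> < F b" by (metis eventually_happens trivial_limit_at_top_linorder)
  have "(F \<longlongrightarrow> (\<Sum>i\<in>J. 0)) at_bot"
    unfolding F_def by (intro tendsto_sum finite_borel_measure.cdf_lim_at_bot fbm)
  then have "eventually (\<lambda>x. F x < \<rho>) at_bot" using assms(3) by (intro order_tendstoD) auto
  then obtain a where a: "F a < \<rho>" by (metis eventually_happens trivial_limit_at_bot_linorder)
  define X where "X = {x. \<rho> \<le> F x}"
  define q where "q = Inf X"
  have X: "b \<in> X" "bdd_below X"
  proof -
    have "a \<le> x" if "x \<in> X" for x
      using that a mono[of x a] by (cases "a \<le> x") (auto simp: X_def)
    then show "bdd_below X" by (rule bdd_belowI)
    show "b \<in> X" using b by (simp add: X_def)
  qed
  have above: "\<rho> \<le> F x" if qx: "q < x" for x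
  proof -
    obtain y where "y \<in> X" "y < x" using cInf_lessD[of X x] qx X by (auto simp: q_def)
    then show ?thesis using mono[of y x] by (auto simp: X_def)
  qed
  have below: "F x \<le> \<rho>" if "x < q" for x
    using that X(2) cInf_lower[of x X] by (force simp: X_def q_def)
  have "(F \<longlongrightarrow> F q) (at_right q)"
    unfolding F_def
    by (intro tendsto_sum) (use finite_borel_measure.cdf_is_right_cont[OF fbm] in \<open>auto simp: continuous_within\<close>)
  then have "\<rho> \<le> F q"
    by (rule tendsto_lowerbound) (auto intro!: above always_eventually simp: eventually_at_filter)
  moreover have "(F \<longlongrightarrow> (\<Sum>i\<in>J. measure (\<nu> i) {..<q})) (at_left q)"
    unfolding F_def by (intro tendsto_sum finite_borel_measure.cdf_at_left fbm)
  then have "(\<Sum>i\<in>J. measure (\<nu> i) {..<q}) \<le> \<rho>"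
    by (rule tendsto_upperbound) (auto intro!: below always_eventually simp: eventually_at_filter)
  ultimately show ?thesis by (auto simp: F_def cdf_def)
qed

text \<open>Reflection at 0 exchanges the two tails, so the negative of a lower quantile of the
  reflected laws will do.\<close>

lemma exists_common_upper_quantile:
  fixes \<nu> :: "'i \<Rightarrow> real measure" and \<rho> :: real
  assumes "finite J" "\<And>i. i \<in> J \<Longrightarrow> real_distribution (\<nu> i)" "0 < \<rho>" "\<rho> < card J"
  shows "\<exists>q. (\<Sum>i\<in>J. measure (\<nu> i) {q<..}) \<le> \<rho> \<and> \<rho> \<le> (\<Sum>i\<in>J. measure (\<nu> i) {q..})"
proof -
  have d: "real_distribution (distr (\<nu> i) borel uminus)" if "i \<in> J" for i
    using assms(2)[OF that]
    by (intro real_distribution.intro prob_space.prob_space_distr real_distribution_axioms.intro)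
       (auto simp: real_distribution_def real_distribution.events_eq_borel cong: measurable_cong_sets)
  have m: "measure (distr (\<nu> i) borel uminus) B = measure (\<nu> i) (uminus -` B)"
    if "i \<in> J" "B \<in> sets borel" for i B
  proof -
    interpret real_distribution "\<nu> i" by (rule assms(2)[OF that(1)])
    show ?thesis using that(2) by (subst measure_distr) auto
  qed
  obtain q where q: "(\<Sum>i\<in>J. measure (distr (\<nu> i) borel uminus) {..<q}) \<le> \<rho>"
      "\<rho> \<le> (\<Sum>i\<in>J. measure (distr (\<nu> i) borel uminus) {..q})"
    using exists_common_quantile[of J "\<lambda>i. distr (\<nu> i) borel uminus" \<rho>] assms d by blast
  have "uminus -` {..<q} = {- q<..}" "uminus -` {..q} = {- q..}" by auto
  then show ?thesis using q by (intro exI[of _ "- q"]) (simp add: m)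
qed

section \<open>Sums of independent variables and laws of sample means\<close>

lemma (in prob_space) indep_vars_sum_squares:
  fixes X :: "'i \<Rightarrow> 'a \<Rightarrow> real"
  assumes "finite S" "indep_vars (\<lambda>_. borel) X S"
    and sq: "\<And>t. t \<in> S \<Longrightarrow> integrable M (\<lambda>x. (X t x)\<^sup>2)" and zero: "\<And>t. t \<in> S \<Longrightarrow> expectation (X t) = 0"
  shows "integrable M (\<lambda>x. (\<Sum>t\<in>S. X t x)\<^sup>2)"
    and "expectation (\<lambda>x. (\<Sum>t\<in>S. X t x)\<^sup>2) = (\<Sum>t\<in>S. expectation (\<lambda>x. (X t x)\<^sup>2))"
proof -
  have rv: "X t \<in> borel_measurable M" if "t \<in> S" for t
    using assms(2) that by (auto simp: indep_vars_def)
  have int: "integrable M (X t)" if "t \<in> S" for t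
    using square_integrable_imp_integrable[OF rv[OF that] sq[OF that]] .
  have prod: "integrable M (\<lambda>x. X t x * X u x)"
      "expectation (\<lambda>x. X t x * X u x) = (if t = u then expectation (\<lambda>x. (X t x)\<^sup>2) else 0)"
    if "t \<in> S" "u \<in> S" for t u
  proof -
    have "integrable M (\<lambda>x. X t x * X u x) \<and> expectation (\<lambda>x. X t x * X u x) = 0" if "t \<noteq> u"
    proof -
      have ind: "indep_vars (\<lambda>_. borel) X {t, u}"
        using \<open>t \<in> S\<close> \<open>u \<in> S\<close> by (intro indep_vars_subset[OF assms(2)]) auto
      have i: "integrable M (X i)" if "i \<in> {t, u}" for i using that \<open>t \<in> S\<close> \<open>u \<in> S\<close> int by auto
      show ?thesis
        using indep_vars_lebesgue_integral[OF _ ind i] indep_vars_integrable[OF _ ind i] \<open>t \<noteq> u\<close>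
          zero \<open>t \<in> S\<close> by simp
    qed
    then show "integrable M (\<lambda>x. X t x * X u x)"
      "expectation (\<lambda>x. X t x * X u x) = (if t = u then expectation (\<lambda>x. (X t x)\<^sup>2) else 0)"
      using sq[OF \<open>t \<in> S\<close>] by (auto simp: power2_eq_square)
  qed
  have eq: "(\<lambda>x. (\<Sum>t\<in>S. X t x)\<^sup>2) = (\<lambda>x. \<Sum>t\<in>S. \<Sum>u\<in>S. X t x * X u x)"
    by (simp add: power2_eq_square sum_product)
  show "integrable M (\<lambda>x. (\<Sum>t\<in>S. X t x)\<^sup>2)" unfolding eq using prod by auto
  show "expectation (\<lambda>x. (\<Sum>t\<in>S. X t x)\<^sup>2) = (\<Sum>t\<in>S. expectation (\<lambda>x. (X t x)\<^sup>2))"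
    unfolding eq using prod assms(1) by (simp add: Bochner_Integration.integral_sum sum.delta)
qed

lemma indep_vars_PiM_coordinates:
  assumes "S \<noteq> {}" and D: "\<And>i. i \<in> S \<Longrightarrow> prob_space (D i)"
  shows "prob_space.indep_vars (PiM S D) D (\<lambda>i x. x i) S"
proof -
  interpret prob_space "PiM S D" using D by (rule prob_space_PiM)
  have "distr (PiM S D) (PiM S D) (\<lambda>x. \<lambda>i\<in>S. x i) = distr (PiM S D) (PiM S D) (\<lambda>x. x)"
    by (intro distr_cong) (auto simp: space_PiM)
  then show ?thesis
    using assms(1) by (subst indep_vars_iff_distr_eq_PiM')
      (auto simp: distr_id[unfolded id_def] intro!: PiM_cong distr_PiM_component[symmetric] D)
qed

text \<open>The index set is kept rather than its size, since it will be the set of steps at which a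
  user arrives. For empty \<open>S\<close> the division by 0 gives the point mass at 0.\<close>

definition sample_mean_law :: "real measure \<Rightarrow> 'i set \<Rightarrow> real measure" where
  "sample_mean_law D S = distr (\<Pi>\<^sub>M t\<in>S. D) borel (\<lambda>x. (\<Sum>t\<in>S. x t) / real (card S))"

lemma real_distribution_sample_mean_law:
  assumes "real_distribution D"
  shows "real_distribution (sample_mean_law D S)"
proof -
  interpret D: real_distribution D by fact
  have "prob_space (sample_mean_law D S)"
    unfolding sample_mean_law_def by (intro prob_space.prob_space_distr prob_space_PiM D.prob_space_axioms) simp
  then show ?thesis
    by (simp add: real_distribution_def real_distribution_axioms_def sample_mean_law_def)
qed

text \<open>The centred coordinates of the product space are independent with mean 0, so their
  second moments add up.\<close>

lemma sample_mean_law_moments: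
  fixes m :: real
  assumes "real_distribution D" "finite S" "S \<noteq> {}" "integrable D (\<lambda>x. x\<^sup>2)" "m = (\<integral>x. x \<partial>D)"
  shows "integrable (sample_mean_law D S) (\<lambda>y. (y - m)\<^sup>2)"
    and "(\<integral>y. (y - m)\<^sup>2 \<partial>sample_mean_law D S) = (\<integral>x. (x - m)\<^sup>2 \<partial>D) / card S"
    and "integrable (sample_mean_law D S) (\<lambda>y. y - m)"
    and "(\<integral>y. y - m \<partial>sample_mean_law D S) = 0"
proof -
  interpret D: real_distribution D by fact
  let ?P = "\<Pi>\<^sub>M t\<in>S. D"
  interpret P: prob_space ?P by (intro prob_space_PiM D.prob_space_axioms)
  define X where "X t x = x t - m" for t and x :: "'a \<Rightarrow> real"
  have comp: "integrable ?P (\<lambda>x. f (x t)) = integrable D f" "(\<integral>x. f (x t) \<partial>?P) = (\<integral>y. f y \<partial>D)"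
    if "t \<in> S" "f \<in> borel_measurable borel" for t and f :: "real \<Rightarrow> real"
  proof -
    have e: "distr ?P D (\<lambda>\<omega>. \<omega> t) = D"
      by (rule distr_PiM_component) (auto simp: that D.prob_space_axioms)
    have [measurable]: "(\<lambda>\<omega>. \<omega> t) \<in> ?P \<rightarrow>\<^sub>M D" using that(1) by simp
    have [measurable]: "f \<in> borel_measurable D" using that(2) by simp
    show "integrable ?P (\<lambda>x. f (x t)) = integrable D f"
      by (subst (2) e[symmetric], subst integrable_distr_eq) auto
    show "(\<integral>x. f (x t) \<partial>?P) = (\<integral>y. f y \<partial>D)"
      by (subst (2) e[symmetric], subst integral_distr) auto
  qed
  have intD: "integrable D (\<lambda>x. x)"
    by (rule D.square_integrable_imp_integrable) (use assms(4) in auto)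
  have sqD: "integrable D (\<lambda>x. (x - m)\<^sup>2)"
    using assms(4) intD by (simp add: power2_diff)
  have ind: "P.indep_vars (\<lambda>_. borel) X S"
    unfolding X_def
    by (rule P.indep_vars_compose2[OF indep_vars_PiM_coordinates]) (auto simp: assms D.prob_space_axioms)
  have sq: "integrable ?P (\<lambda>x. (X t x)\<^sup>2)" "P.expectation (\<lambda>x. (X t x)\<^sup>2) = (\<integral>x. (x - m)\<^sup>2 \<partial>D)"
      "integrable ?P (X t)" "P.expectation (X t) = 0" if "t \<in> S" for t
  proof -
    have f: "(\<lambda>y. (y - m)\<^sup>2) \<in> borel_measurable borel" "(\<lambda>y. y - m) \<in> borel_measurable borel"
      by measurable
    have i: "integrable D (\<lambda>y. y - m)" using intD by simp
    have e: "integrable ?P (\<lambda>x. (x t - m)\<^sup>2)" "(\<integral>x. (x t - m)\<^sup>2 \<partial>?P) = (\<integral>x. (x - m)\<^sup>2 \<partial>D)"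
      "integrable ?P (\<lambda>x. x t - m)" "(\<integral>x. x t - m \<partial>?P) = (\<integral>x. x - m \<partial>D)"
      by (rule comp(1)[OF that f(1), THEN iffD2, OF sqD] comp(2)[OF that f(1)]
          comp(1)[OF that f(2), THEN iffD2, OF i] comp(2)[OF that f(2)])+
    have "(\<integral>x. x - m \<partial>D) = 0" using intD D.prob_space by (simp add: assms(5))
    with e show "integrable ?P (\<lambda>x. (X t x)\<^sup>2)" "P.expectation (\<lambda>x. (X t x)\<^sup>2) = (\<integral>x. (x - m)\<^sup>2 \<partial>D)"
      "integrable ?P (X t)" "P.expectation (X t) = 0"
      by (simp_all add: X_def[abs_def])
  qed
  note ss = P.indep_vars_sum_squares[OF assms(2) ind sq(1,4)]
  have card: "real (card S) > 0" using assms by (simp add: card_gt_0_iff)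
  have avg: "(\<Sum>t\<in>S. x t) / real (card S) - m = (\<Sum>t\<in>S. X t x) / real (card S)" for x
    using card by (simp add: X_def sum_subtractf field_simps)
  have [measurable]: "(\<lambda>x. \<Sum>t\<in>S. x t) \<in> borel_measurable ?P" by simp
  show "integrable (sample_mean_law D S) (\<lambda>y. (y - m)\<^sup>2)"
    unfolding sample_mean_law_def
    by (subst integrable_distr_eq) (auto simp: avg power_divide intro!: ss)
  show "(\<integral>y. (y - m)\<^sup>2 \<partial>sample_mean_law D S) = (\<integral>x. (x - m)\<^sup>2 \<partial>D) / card S"
    unfolding sample_mean_law_def
    by (subst integral_distr, simp_all add: avg power_divide ss sq)
      (use card in \<open>simp add: power2_eq_square\<close>)
  show "integrable (sample_mean_law D S) (\<lambda>y. y - m)"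
    unfolding sample_mean_law_def
    by (subst integrable_distr_eq) (use sq in \<open>auto simp: avg\<close>)
  show "(\<integral>y. y - m \<partial>sample_mean_law D S) = 0"
    unfolding sample_mean_law_def
    by (subst integral_distr) (use sq in \<open>auto simp: avg\<close>)
qed

section \<open>Exponential moments and tails of a single variable\<close>

lemma exp_le_quadratic:
  fixes z :: real
  assumes "\<bar>z\<bar> \<le> 1"
  shows "exp z \<le> 1 + z + z\<^sup>2"
proof (cases "0 \<le> z")
  case True
  then show ?thesis using exp_bound[of z] assms by simp
next
  case False
  \<comment> \<open>The product below is \<open>1 - z ^ 3\<close>, which is at least 1 for negative
    \<open>z\<close>; comparing \<open>1 - z\<close> with \<open>exp (- z)\<close> then
    finishes.\<close>
  have "0 \<le> (- z) ^ 3" using False by simp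
  then have "1 \<le> (1 - z) * (1 + z + z\<^sup>2)"
    by (simp add: power2_eq_square power3_eq_cube algebra_simps)
  moreover have "(1 - z) * exp z \<le> exp (- z) * exp z"
    using exp_ge_add_one_self[of "- z"] by (intro mult_right_mono) auto
  then have "(1 - z) * exp z \<le> 1" by (simp add: exp_minus)
  ultimately have "(1 - z) * exp z \<le> (1 - z) * (1 + z + z\<^sup>2)" by linarith
  then show ?thesis using False by simp
qed

text \<open>Truncation brings the exponent into the range of the quadratic bound. Writing the linear
  term with \<open>x\<close> instead of its truncation costs a second copy of the quadratic term; in
  return the linear term integrates to 0 for centred \<open>x\<close>, and a bound on the second
  moment is enough.\<close>

lemma exp_clip_le:
  fixes x s \<theta> :: real
  assumes "0 < s" "\<bar>\<theta>\<bar> = 1"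
  shows "exp (\<theta> * clip (- s) s x / s) \<le> 1 + \<theta> * x / s + 2 * x\<^sup>2 / s\<^sup>2"
proof -
  define z where "z = \<theta> * clip (- s) s x / s"
  define u where "u = \<theta> * x / s"
  have th: "\<theta> = 1 \<or> \<theta> = - 1" using assms(2) by linarith
  have u2: "u\<^sup>2 = x\<^sup>2 / s\<^sup>2" using th by (auto simp: u_def power_divide)
  have z: "z = max (- 1) (min 1 u)"
    using th assms(1) by (auto simp: z_def u_def clip_def max_def min_def field_simps)
  have "exp z \<le> 1 + z + z\<^sup>2" by (rule exp_le_quadratic) (auto simp: z)
  also have "\<dots> \<le> 1 + u + 2 * u\<^sup>2"
  proof -
    consider "u \<le> - 1" | "- 1 \<le> u" "u \<le> 1" | "1 \<le> u" by linarith
    then show ?thesis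
    proof cases
      case 1
      then have "0 \<le> u * (1 + 2 * u)" by (intro mult_nonpos_nonpos) auto
      then show ?thesis using 1 by (simp add: z power2_eq_square algebra_simps)
    next
      case 2
      then show ?thesis by (auto simp: z)
    next
      case 3
      then have "1 \<le> u\<^sup>2" by (simp add: one_le_power)
      then have "2 \<le> u + 2 * u\<^sup>2" using 3 by linarith
      then show ?thesis using 3 by (simp add: z)
    qed
  qed
  finally show ?thesis by (simp add: z_def u_def[symmetric] u2)
qed

context real_distribution
begin

lemma nn_integral_exp_clip_le:
  assumes "0 < s" "\<bar>\<theta>\<bar> = 1" "integrable M (\<lambda>y. (y - m)\<^sup>2)" "integrable M (\<lambda>y. y - m)"
    "(\<integral>y. y - m \<partial>M) = 0" "(\<integral>y. (y - m)\<^sup>2 \<partial>M) \<le> v"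
  shows "(\<integral>\<^sup>+y. ennreal (exp (\<theta> * clip (- s) s (y - m) / s)) \<partial>M) \<le> ennreal (1 + 2 * v / s\<^sup>2)"
proof -
  let ?f = "\<lambda>y. 1 + \<theta> * (y - m) / s + 2 * (y - m)\<^sup>2 / s\<^sup>2"
  have int: "integrable M ?f" using assms by auto
  have "(\<integral>\<^sup>+y. ennreal (exp (\<theta> * clip (- s) s (y - m) / s)) \<partial>M) \<le> (\<integral>\<^sup>+y. ennreal (?f y) \<partial>M)"
    using exp_clip_le[OF assms(1,2)] by (intro nn_integral_mono ennreal_leI) auto
  also have "\<dots> = ennreal (\<integral>y. ?f y \<partial>M)"
    using exp_clip_le[OF assms(1,2)]
    by (intro nn_integral_eq_integral int AE_I2) (meson exp_ge_zero order_trans)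
  also have "(\<integral>y. ?f y \<partial>M) = 1 + 2 * (\<integral>y. (y - m)\<^sup>2 \<partial>M) / s\<^sup>2"
    using assms(3-5) prob_space by simp
  also have "ennreal \<dots> \<le> ennreal (1 + 2 * v / s\<^sup>2)"
    using assms by (intro ennreal_leI add_left_mono divide_right_mono mult_left_mono) auto
  finally show ?thesis .
qed

lemma prob_deviation_le:
  assumes "0 < s" "integrable M (\<lambda>y. (y - m)\<^sup>2)" "(\<integral>y. (y - m)\<^sup>2 \<partial>M) \<le> v"
  shows "prob {y. s < \<bar>y - m\<bar>} \<le> v / s\<^sup>2"
proof -
  have "prob {y. s < \<bar>y - m\<bar>} \<le> prob {y\<in>space M. s\<^sup>2 \<le> (y - m)\<^sup>2}"
    using assms(1) by (intro finite_measure_mono) (auto simp: abs_le_square_iff[symmetric])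
  also have "\<dots> \<le> (\<integral>y. (y - m)\<^sup>2 \<partial>M) / s\<^sup>2"
    using assms by (intro integral_Markov_inequality_measure[where A="{}"]) auto
  also have "\<dots> \<le> v / s\<^sup>2" using assms by (intro divide_right_mono) auto
  finally show ?thesis .
qed

lemma nn_integral_exp_indicator:
  assumes "B \<in> sets borel"
  shows "(\<integral>\<^sup>+y. ennreal (exp (\<theta> * indicator B y)) \<partial>M) = ennreal (1 + (exp \<theta> - 1) * prob B)"
proof -
  have "(\<integral>\<^sup>+y. ennreal (exp (\<theta> * indicator B y)) \<partial>M)
      = (\<integral>\<^sup>+y. ennreal (1 + (exp \<theta> - 1) * indicator B y) \<partial>M)"
    by (intro nn_integral_cong) (auto split: split_indicator)
  also have "\<dots> = ennreal (\<integral>y. 1 + (exp \<theta> - 1) * indicator B y \<partial>M)"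
    using assms
    by (intro nn_integral_eq_integral AE_I2 Bochner_Integration.integrable_add integrable_mult_right
        integrable_real_indicator) (auto split: split_indicator simp: emeasure_eq_measure)
  also have "(\<integral>y. 1 + (exp \<theta> - 1) * indicator B y \<partial>M) = 1 + (exp \<theta> - 1) * prob B"
    using assms prob_space by (subst Bochner_Integration.integral_add) (auto simp: emeasure_eq_measure)
  finally show ?thesis .
qed

end

section \<open>The conditional law of the rewards\<close>

text \<open>The blocks \<open>K j\<close> are disjoint, so the restrictions of a product sample to
  them are independent, and each restriction is again a product sample.\<close>

lemma nn_integral_PiM_block_means:
  fixes K :: "'j \<Rightarrow> 'i set" and h :: "'j \<Rightarrow> real \<Rightarrow> ennreal"
  assumes D: "real_distribution D" and J: "finite J" "disjoint_family_on K J"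
    and K: "\<And>j. j \<in> J \<Longrightarrow> finite (K j) \<and> K j \<noteq> {}"
    and h: "\<And>j. j \<in> J \<Longrightarrow> h j \<in> borel_measurable borel"
  shows "(\<integral>\<^sup>+x. (\<Prod>j\<in>J. h j ((\<Sum>t\<in>K j. x t) / card (K j))) \<partial>(\<Pi>\<^sub>M t\<in>(\<Union>j\<in>J. K j). D))
    = (\<Prod>j\<in>J. \<integral>\<^sup>+y. h j y \<partial>sample_mean_law D (K j))"
proof (cases "J = {}")
  case True
  interpret real_distribution D by fact
  interpret P: prob_space "\<Pi>\<^sub>M t\<in>{}. D" by (intro prob_space_PiM prob_space_axioms)
  show ?thesis using True by (simp add: P.emeasure_space_1)
next
  case False
  interpret D: real_distribution D by fact
  define S where "S = (\<Union>j\<in>J. K j)"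
  have S: "S \<noteq> {}" "finite S"
  proof -
    obtain j where "j \<in> J" using False by blast
    then show "S \<noteq> {}" using K[of j] unfolding S_def by blast
    show "finite S" unfolding S_def using J K by blast
  qed
  interpret product_prob_space "\<lambda>_. D" S by standard
  interpret P: prob_space "\<Pi>\<^sub>M t\<in>S. D" by (intro prob_space_PiM D.prob_space_axioms)
  define g where "g j x = h j ((\<Sum>t\<in>K j. x t) / card (K j))" for j and x :: "'i \<Rightarrow> real"
  have gm: "g j \<in> borel_measurable (\<Pi>\<^sub>M t\<in>K j. D)" if "j \<in> J" for j
    unfolding g_def using h[OF that] by (intro measurable_compose[OF _ h[OF that]]) simp
  have "P.indep_vars (\<lambda>j. \<Pi>\<^sub>M t\<in>K j. D) (\<lambda>j x. restrict (\<lambda>t. x t) (K j)) J"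
    using J S(1) by (intro P.indep_vars_restrict[OF indep_vars_PiM_coordinates])
      (assumption | force simp: D.prob_space_axioms S_def)+
  then have "P.indep_vars (\<lambda>_. borel) (\<lambda>j x. g j (restrict x (K j))) J"
    by (rule P.indep_vars_compose2) (rule gm)
  then have "(\<integral>\<^sup>+x. (\<Prod>j\<in>J. g j (restrict x (K j))) \<partial>(\<Pi>\<^sub>M t\<in>S. D))
      = (\<Prod>j\<in>J. \<integral>\<^sup>+x. g j (restrict x (K j)) \<partial>(\<Pi>\<^sub>M t\<in>S. D))"
    using J by (intro P.indep_vars_nn_integral) auto
  also have "\<dots> = (\<Prod>j\<in>J. \<integral>\<^sup>+y. h j y \<partial>sample_mean_law D (K j))"
  proof (intro prod.cong refl)
    fix j assume j: "j \<in> J"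
    have sub: "K j \<subseteq> S" using j by (auto simp: S_def)
    have "(\<integral>\<^sup>+x. g j (restrict x (K j)) \<partial>(\<Pi>\<^sub>M t\<in>S. D))
        = (\<integral>\<^sup>+x. g j x \<partial>distr (\<Pi>\<^sub>M t\<in>S. D) (\<Pi>\<^sub>M t\<in>K j. D) (\<lambda>x. restrict x (K j)))"
      using gm[OF j] sub by (intro nn_integral_distr[symmetric] measurable_restrict_subset) auto
    also have "distr (\<Pi>\<^sub>M t\<in>S. D) (\<Pi>\<^sub>M t\<in>K j. D) (\<lambda>x. restrict x (K j)) = (\<Pi>\<^sub>M t\<in>K j. D)"
      using K j sub by (intro distr_PiM_restrict_finite) auto
    also have "(\<integral>\<^sup>+x. g j x \<partial>(\<Pi>\<^sub>M t\<in>K j. D)) = (\<integral>\<^sup>+y. h j y \<partial>sample_mean_law D (K j))"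
      unfolding sample_mean_law_def g_def using h[OF j] by (intro nn_integral_distr[symmetric]) auto
    finally show "(\<integral>\<^sup>+x. g j (restrict x (K j)) \<partial>(\<Pi>\<^sub>M t\<in>S. D)) = (\<integral>\<^sup>+y. h j y \<partial>sample_mean_law D (K j))" .
  qed
  finally show ?thesis by (simp add: g_def S_def)
qed

text \<open>The space \<open>N\<close> is general because this is applied to \<open>M\<close>, to a
  history and to the space of arrival paths.\<close>

lemma cylinder_sets:
  fixes T :: nat
  assumes "\<And>t. (\<lambda>\<omega>. X \<omega> t) \<in> N \<rightarrow>\<^sub>M count_space UNIV"
  shows "{\<omega>\<in>space N. \<forall>t<T. X \<omega> t = w t} \<in> sets N"
proof -
  have "{\<omega>\<in>space N. X \<omega> t = w t} = (\<lambda>\<omega>. X \<omega> t) -` {w t} \<inter> space N" for t by auto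
  then have "{\<omega>\<in>space N. X \<omega> t = w t} \<in> sets N" for t using measurable_sets[OF assms, of "{w t}" t] by simp
  then have "{\<omega>\<in>space N. \<forall>t\<in>{..<T}. X \<omega> t = w t} \<in> sets N"
    by (intro sets.sets_Collect_finite_All) auto
  then show ?thesis by (simp only: Ball_def lessThan_iff)
qed

section \<open>Events that fix the seed and the first arrivals\<close>

locale grouped_bandit = corrupted_bandit +
  assumes grouping: "random_grouping M L A seed user act"
    and A_pos: "0 < A"
begin

abbreviation hist :: "nat \<Rightarrow> 'a measure" where
  "hist t \<equiv> history M seed user rew t"

definition arrival_event :: "nat \<Rightarrow> (nat \<Rightarrow> nat) \<Rightarrow> 'a set" where
  "arrival_event T w = {\<omega>\<in>space M. \<forall>t<T. user t \<omega> = w t}"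

text \<open>On such an event the groups, the steps of each user before \<open>T\<close> and the arms
  that group members play at these steps are determined. Conditioning on it is elementary whenever
  it has positive probability.\<close>

definition run_event :: "nat \<Rightarrow> nat list \<Rightarrow> (nat \<Rightarrow> nat) \<Rightarrow> 'a set" where
  "run_event T p w = {\<omega>\<in>space M. seed \<omega> = p \<and> (\<forall>t<T. user t \<omega> = w t)}"

text \<open>Part of \<open>indep_set\<close> is that both families consist of events; measurability
  of the seed, and likewise of the arrivals, is read off from this.\<close>

lemma seed_measurable [measurable]: "seed \<in> M \<rightarrow>\<^sub>M count_space UNIV"
proof (rule measurableI)
  show "seed -` B \<inter> space M \<in> sets M" if "B \<in> sets (count_space UNIV)" for B
    using indep_setD_ev1[OF arrivals_indep_seed] in_vimage_algebra[OF that, of seed "space M"] by blast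
qed simp

lemma arrivals_measurable: "(\<lambda>\<omega> s. user s \<omega>) \<in> M \<rightarrow>\<^sub>M (\<Pi>\<^sub>M s\<in>UNIV. count_space UNIV)"
proof (rule measurableI)
  show "(\<lambda>\<omega> s. user s \<omega>) -` B \<inter> space M \<in> sets M" if "B \<in> sets (\<Pi>\<^sub>M s\<in>UNIV. count_space UNIV)" for B
    using indep_setD_ev2[OF arrivals_indep_seed]
      in_vimage_algebra[OF that, of "\<lambda>\<omega> s. user s \<omega>" "space M"] by blast
qed (simp add: space_PiM)

lemma user_measurable [measurable]: "user t \<in> M \<rightarrow>\<^sub>M count_space UNIV"
proof -
  have "(\<lambda>\<omega>. (\<lambda>s. user s \<omega>) t) \<in> M \<rightarrow>\<^sub>M count_space UNIV"
    by (rule measurable_compose[OF arrivals_measurable measurable_component_singleton[OF UNIV_I]])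
  then show ?thesis by simp
qed

declare rew_measurable [measurable]

lemma arrival_event_sets [measurable]: "arrival_event T w \<in> sets M"
  unfolding arrival_event_def
  by (rule cylinder_sets[of "\<lambda>\<omega> s. user s \<omega>"]) (rule user_measurable)

lemma run_event_sets [measurable]: "run_event T p w \<in> sets M"
proof -
  have "run_event T p w = (seed -` {p} \<inter> space M) \<inter> arrival_event T w"
    by (auto simp: run_event_def arrival_event_def)
  moreover have "seed -` {p} \<inter> space M \<in> sets M"
    by (rule measurable_sets[OF seed_measurable]) simp
  ultimately show ?thesis by auto
qed

text \<open>Independence of seed and arrivals factorises the probability, and the uniform law gives
  each of the \<open>fact L\<close> orders the same share.\<close>

lemma prob_run_event:
  assumes "p \<in> permutations_of_set {..<L}"
  shows "prob (run_event T p w) = prob (arrival_event T w) / fact L"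
proof -
  have s: "seed -` {p} \<inter> space M \<in> sets (vimage_algebra (space M) seed (count_space UNIV))"
    by (intro in_vimage_algebra) simp
  have sets: "{f \<in> space (\<Pi>\<^sub>M s\<in>(UNIV :: nat set). count_space (UNIV :: nat set)). \<forall>t<T. f t = w t}
      \<in> sets (\<Pi>\<^sub>M s\<in>UNIV. count_space UNIV)"
    by (rule cylinder_sets) (rule measurable_component_singleton[OF UNIV_I])
  have eq: "(\<lambda>\<omega> s. user s \<omega>) -` {f \<in> space (\<Pi>\<^sub>M s\<in>UNIV. count_space UNIV). \<forall>t<T. f t = w t} \<inter> space M
      = arrival_event T w"
    by (auto simp: arrival_event_def space_PiM)
  have u: "arrival_event T w
      \<in> sets (vimage_algebra (space M) (\<lambda>\<omega> s. user s \<omega>) (\<Pi>\<^sub>M s\<in>UNIV. count_space UNIV))"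
    unfolding eq[symmetric] by (rule in_vimage_algebra[OF sets])
  have "run_event T p w = (seed -` {p} \<inter> space M) \<inter> arrival_event T w"
    by (auto simp: run_event_def arrival_event_def)
  then have "prob (run_event T p w) = prob (seed -` {p} \<inter> space M) * prob (arrival_event T w)"
    using indep_setD[OF arrivals_indep_seed s u] by simp
  also have "prob (seed -` {p} \<inter> space M) = measure (distr M (count_space UNIV) seed) {p}"
    by (subst measure_distr) auto
  also have "distr M (count_space UNIV) seed = measure_pmf (pmf_of_set (permutations_of_set {..<L}))"
    using grouping by (simp add: random_grouping_def)
  also have "measure \<dots> {p} = 1 / fact L"
    using assms by (simp add: measure_pmf_single pmf_of_set)
  finally show ?thesis by simp
qed

section \<open>Histories and the conditional law of good rewards\<close>

lemma history_map_measurable: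
  "(\<lambda>\<omega>. (seed \<omega>, (\<lambda>s. user s \<omega>), (\<lambda>s\<in>{..<t}. rew s \<omega>)))
    \<in> hist t \<rightarrow>\<^sub>M count_space UNIV \<Otimes>\<^sub>M (\<Pi>\<^sub>M s\<in>UNIV. count_space UNIV) \<Otimes>\<^sub>M (\<Pi>\<^sub>M s\<in>{..<t}. borel)"
  unfolding history_def
  by (rule measurable_vimage_algebra1) (auto simp: space_pair_measure space_PiM)

lemma space_history [simp]: "space (hist t) = space M"
  by (simp add: history_def)

lemma subalgebra_history: "subalgebra M (hist t)"
  unfolding subalgebra_def
proof
  have [measurable]: "(\<lambda>\<omega> s. user s \<omega>) \<in> M \<rightarrow>\<^sub>M (\<Pi>\<^sub>M s\<in>UNIV. count_space UNIV)"
    by (rule arrivals_measurable)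
  have "(\<lambda>\<omega>. (seed \<omega>, (\<lambda>s. user s \<omega>), (\<lambda>s\<in>{..<t}. rew s \<omega>)))
    \<in> M \<rightarrow>\<^sub>M count_space UNIV \<Otimes>\<^sub>M (\<Pi>\<^sub>M s\<in>UNIV. count_space UNIV) \<Otimes>\<^sub>M (\<Pi>\<^sub>M s\<in>{..<t}. borel)"
    by measurable
  then show "sets (hist t) \<subseteq> sets M"
    unfolding history_def by (intro sets_image_in_sets) auto
qed simp

lemma history_seed_measurable: "seed \<in> hist t \<rightarrow>\<^sub>M count_space UNIV"
  using measurable_compose[OF history_map_measurable measurable_fst] by (simp only: fst_conv)

lemma history_user_measurable: "user s \<in> hist t \<rightarrow>\<^sub>M count_space UNIV"
proof -
  note m = measurable_compose[OF history_map_measurable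
      measurable_compose[OF measurable_snd measurable_fst]]
  from measurable_compose[OF m measurable_component_singleton[OF UNIV_I], of t s]
  show ?thesis by (simp only: fst_conv snd_conv)
qed

lemma history_rew_measurable:
  assumes "s < t"
  shows "rew s \<in> borel_measurable (hist t)"
proof -
  note m = measurable_compose[OF history_map_measurable
      measurable_compose[OF measurable_snd measurable_snd]]
  have s: "s \<in> {..<t}" using assms by simp
  from measurable_compose[OF m measurable_component_singleton[OF s]] s
  show ?thesis by (simp only: fst_conv snd_conv restrict_apply' if_True)
qed

text \<open>The integrated form of \<open>good_reward\<close>: from an event known before step
  \<open>t\<close>, on which a good user plays \<open>a\<close>, the new reward splits off as a
  factor. The event may involve all earlier rewards, adversarial ones included.\<close>

lemma prob_good_reward:
  assumes C: "C \<in> sets (hist t)" and a: "a < A" and B: "B \<in> sets borel"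
    and on_C: "\<And>\<omega>. \<omega> \<in> C \<Longrightarrow> user t \<omega> \<in> good \<and> act t \<omega> = a"
  shows "prob (C \<inter> {\<omega>\<in>space M. rew t \<omega> \<in> B}) = prob C * measure (R a) B"
proof -
  interpret F: finite_measure_subalgebra M "hist t"
    by unfold_locales (rule subalgebra_history)
  have CM: "C \<in> sets M" using C subalgebra_history by (auto simp: subalgebra_def)
  note [measurable] = CM B
  have int: "integrable M (\<lambda>\<omega>. indicator B (rew t \<omega>) :: real)"
    by (rule integrable_const_bound[of _ 1]) (auto split: split_indicator)
  have "prob (C \<inter> {\<omega>\<in>space M. rew t \<omega> \<in> B}) = (\<integral>\<omega>. indicator (C \<inter> {\<omega>\<in>space M. rew t \<omega> \<in> B}) \<omega> \<partial>M)"
    by simp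
  also have "\<dots> = (\<integral>\<omega>\<in>C. indicator B (rew t \<omega>) \<partial>M)"
    unfolding set_lebesgue_integral_def
    by (intro Bochner_Integration.integral_cong) (auto split: split_indicator)
  also have "\<dots> = (\<integral>\<omega>\<in>C. real_cond_exp M (hist t) (\<lambda>\<omega>. indicator B (rew t \<omega>)) \<omega> \<partial>M)"
    by (rule F.real_cond_exp_intA[OF int C])
  also have "\<dots> = (\<integral>\<omega>\<in>C. measure (R a) B \<partial>M)"
    unfolding set_lebesgue_integral_def
  proof (intro integral_cong_AE)
    show "AE \<omega> in M. indicator C \<omega> *\<^sub>R real_cond_exp M (hist t) (\<lambda>\<omega>. indicator B (rew t \<omega>)) \<omega>
        = indicator C \<omega> *\<^sub>R measure (R a) B"
      using good_reward[OF B, of t] by (rule AE_mp) (intro AE_I2, use on_C in \<open>auto split: split_indicator\<close>)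
  qed auto
  also have "\<dots> = prob C * measure (R a) B"
    by (simp add: set_lebesgue_integral_def)
  finally show ?thesis .
qed

text \<open>A history contains the whole arrival path and not only its past, so this holds for every
  \<open>t\<close>, in particular before \<open>T\<close>.\<close>

lemma run_event_history: "run_event T p w \<in> sets (hist t)"
proof -
  have "run_event T p w = (seed -` {p} \<inter> space (hist t)) \<inter> {\<omega>\<in>space (hist t). \<forall>t<T. user t \<omega> = w t}"
    by (auto simp: run_event_def)
  moreover have "seed -` {p} \<inter> space (hist t) \<in> sets (hist t)"
    by (rule measurable_sets[OF history_seed_measurable]) simp
  moreover have "{\<omega>\<in>space (hist t). \<forall>t<T. user t \<omega> = w t} \<in> sets (hist t)"
    by (rule cylinder_sets) (rule history_user_measurable)
  ultimately show ?thesis by (simp only: sets.Int)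
qed

lemma act_on_run_event:
  assumes "\<omega> \<in> run_event T p w" "t < T" "a < A" "w t \<in> set (user_group L A p a)"
  shows "act t \<omega> = a"
  using assms grouping by (auto simp: run_event_def random_grouping_def)

text \<open>Rewards are added in the order of time: the run together with the conditions on rewards
  before step \<open>n\<close> is an event of the history at \<open>n\<close>, so the reward at
  \<open>n\<close> contributes its own factor. Steps outside \<open>S\<close> are passed
  over.\<close>

lemma prob_run_event_rewards:
  assumes a: "a < A" and S: "S \<subseteq> {..<T}"
    and w: "\<And>t. t \<in> S \<Longrightarrow> w t \<in> good \<inter> set (user_group L A p a)"
    and B: "\<And>t. t \<in> S \<Longrightarrow> B t \<in> sets borel"
  shows "prob (run_event T p w \<inter> {\<omega>\<in>space M. \<forall>t\<in>S. rew t \<omega> \<in> B t})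
    = prob (run_event T p w) * (\<Prod>t\<in>S. measure (R a) (B t))"
proof -
  let ?E = "run_event T p w"
  have fin: "finite S" using S finite_subset by blast
  have "prob (?E \<inter> {\<omega>\<in>space M. \<forall>t\<in>S \<inter> {..<n}. rew t \<omega> \<in> B t})
      = prob ?E * (\<Prod>t\<in>S \<inter> {..<n}. measure (R a) (B t))" for n
  proof (induction n)
    case 0
    have "?E \<inter> space M = ?E" by (auto simp: run_event_def)
    then show ?case by simp
  next
    case (Suc n)
    show ?case
    proof (cases "n \<in> S")
      case False
      then have "S \<inter> {..<Suc n} = S \<inter> {..<n}" by (auto simp: less_Suc_eq)
      then show ?thesis using Suc by simp
    next
      case True
      let ?C = "?E \<inter> {\<omega>\<in>space M. \<forall>t\<in>S \<inter> {..<n}. rew t \<omega> \<in> B t}"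
      have eq: "S \<inter> {..<Suc n} = insert n (S \<inter> {..<n})" using True by auto
      have "{\<omega>\<in>space (hist n). \<forall>t\<in>S \<inter> {..<n}. rew t \<omega> \<in> B t} \<in> sets (hist n)"
        using fin B history_rew_measurable
        by (intro sets.sets_Collect_finite_All measurable_sets_Collect[OF history_rew_measurable]) auto
      then have C: "?C \<in> sets (hist n)"
        using run_event_history by (intro sets.Int) auto
      have on_C: "user n \<omega> \<in> good \<and> act n \<omega> = a" if "\<omega> \<in> ?C" for \<omega>
      proof
        have "\<omega> \<in> ?E" "n < T" using that True S by auto
        then show "user n \<omega> \<in> good" using w[OF True] by (auto simp: run_event_def)
        show "act n \<omega> = a" using \<open>\<omega> \<in> ?E\<close> \<open>n < T\<close> a w[OF True] by (intro act_on_run_event) auto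
      qed
      have "?E \<inter> {\<omega>\<in>space M. \<forall>t\<in>S \<inter> {..<Suc n}. rew t \<omega> \<in> B t} = ?C \<inter> {\<omega>\<in>space M. rew n \<omega> \<in> B n}"
        unfolding eq by auto
      then have "prob (?E \<inter> {\<omega>\<in>space M. \<forall>t\<in>S \<inter> {..<Suc n}. rew t \<omega> \<in> B t}) = prob ?C * measure (R a) (B n)"
        using prob_good_reward[OF C a B[OF True] on_C] by simp
      then show ?thesis using Suc fin unfolding eq by simp
    qed
  qed
  from this[of T] show ?thesis using S by (simp add: Int_absorb2)
qed

lemma real_distribution_R:
  assumes "a < A"
  shows "real_distribution (R a)"
  using reward_prob_space[OF assms] reward_sets[OF assms]
  by (simp add: real_distribution_def real_distribution_axioms_def)

text \<open>Here \<open>uniform_measure\<close> is the conditional probability given the run.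
  Rectangles determine a product measure, and their probabilities have just been computed.\<close>

lemma distr_rewards_run_event:
  assumes a: "a < A" and S: "S \<subseteq> {..<T}"
    and w: "\<And>t. t \<in> S \<Longrightarrow> w t \<in> good \<inter> set (user_group L A p a)"
    and pos: "0 < prob (run_event T p w)"
  shows "distr (uniform_measure M (run_event T p w)) (\<Pi>\<^sub>M t\<in>S. borel) (\<lambda>\<omega>. \<lambda>t\<in>S. rew t \<omega>) = (\<Pi>\<^sub>M t\<in>S. R a)"
proof -
  let ?E = "run_event T p w"
  interpret R: real_distribution "R a" by (rule real_distribution_R[OF a])
  interpret product_sigma_finite "\<lambda>_. R a" by standard
  have fin: "finite S" using S finite_subset by blast
  have meas: "(\<lambda>\<omega>. \<lambda>t\<in>S. rew t \<omega>) \<in> uniform_measure M ?E \<rightarrow>\<^sub>M (\<Pi>\<^sub>M t\<in>S. borel)"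
    by measurable
  show ?thesis
  proof (rule PiM_eqI[OF fin])
    show "sets (distr (uniform_measure M ?E) (\<Pi>\<^sub>M t\<in>S. borel) (\<lambda>\<omega>. \<lambda>t\<in>S. rew t \<omega>)) = sets (\<Pi>\<^sub>M t\<in>S. R a)"
      by (simp cong: sets_PiM_cong)
    fix B assume B': "\<And>t. t \<in> S \<Longrightarrow> B t \<in> sets (R a)"
    then have B: "\<And>t. t \<in> S \<Longrightarrow> B t \<in> sets borel" by simp
    have "Pi\<^sub>E S B \<in> sets (\<Pi>\<^sub>M t\<in>S. borel)" using fin B by (intro sets_PiM_I_finite) auto
    moreover have "(\<lambda>\<omega>. \<lambda>t\<in>S. rew t \<omega>) -` Pi\<^sub>E S B \<inter> space M = {\<omega>\<in>space M. \<forall>t\<in>S. rew t \<omega> \<in> B t}"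
      by (auto simp: PiE_iff)
    moreover have "{\<omega>\<in>space M. \<forall>t\<in>S. rew t \<omega> \<in> B t} \<in> sets M"
      using fin B by (intro sets.sets_Collect_finite_All measurable_sets_Collect[OF rew_measurable]) auto
    ultimately have "emeasure (distr (uniform_measure M ?E) (\<Pi>\<^sub>M t\<in>S. borel) (\<lambda>\<omega>. \<lambda>t\<in>S. rew t \<omega>)) (Pi\<^sub>E S B)
        = emeasure M (?E \<inter> {\<omega>\<in>space M. \<forall>t\<in>S. rew t \<omega> \<in> B t}) / emeasure M ?E"
      using meas by (subst emeasure_distr) auto
    also have "\<dots> = ennreal (\<Prod>t\<in>S. measure (R a) (B t))"
      using pos prob_run_event_rewards[OF a S w B]
      by (simp add: emeasure_eq_measure divide_ennreal prod_nonneg)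
    also have "\<dots> = (\<Prod>t\<in>S. emeasure (R a) (B t))"
      by (simp add: R.emeasure_eq_measure prod_ennreal)
    finally show "emeasure (distr (uniform_measure M ?E) (\<Pi>\<^sub>M t\<in>S. borel) (\<lambda>\<omega>. \<lambda>t\<in>S. rew t \<omega>)) (Pi\<^sub>E S B)
        = (\<Prod>t\<in>S. emeasure (R a) (B t))" .
  qed
qed

lemma user_mean_measurable [measurable]: "(\<lambda>\<omega>. user_mean user rew i T \<omega>) \<in> borel_measurable M"
proof -
  have "user_mean user rew i T \<omega> = (\<Sum>s<T. if user s \<omega> = i then rew s \<omega> else 0) /
      (\<Sum>s<T. if user s \<omega> = i then 1 else 0)" for \<omega>
    by (simp add: user_mean_def visits_def sum.If_cases Int_def)
  then show ?thesis by simp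
qed

text \<open>On a fixed run the empirical mean of a user is an average over a fixed set of steps, and
  these sets are disjoint for distinct users. Integrating against the indicator instead of
  conditioning also covers runs of probability 0.\<close>

lemma nn_integral_user_means:
  fixes h :: "nat \<Rightarrow> real \<Rightarrow> ennreal"
  assumes a: "a < A" and J: "J \<subseteq> good \<inter> set (user_group L A p a)"
    and K: "\<And>i. i \<in> J \<Longrightarrow> {t. t < T \<and> w t = i} \<noteq> {}"
    and h: "\<And>i. i \<in> J \<Longrightarrow> h i \<in> borel_measurable borel"
  shows "(\<integral>\<^sup>+\<omega>. (\<Prod>i\<in>J. h i (user_mean user rew i T \<omega>)) * indicator (run_event T p w) \<omega> \<partial>M)
    = emeasure M (run_event T p w) * (\<Prod>i\<in>J. \<integral>\<^sup>+y. h i y \<partial>sample_mean_law (R a) {t. t < T \<and> w t = i})"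
proof (cases "prob (run_event T p w) = 0")
  case True
  then have "AE \<omega> in M. \<omega> \<notin> run_event T p w"
    by (subst AE_iff_measurable[OF run_event_sets(1)]) (auto simp: emeasure_eq_measure run_event_def)
  then have "(\<integral>\<^sup>+\<omega>. (\<Prod>i\<in>J. h i (user_mean user rew i T \<omega>)) * indicator (run_event T p w) \<omega> \<partial>M) = (\<integral>\<^sup>+\<omega>. 0 \<partial>M)"
    by (intro nn_integral_cong_AE) (auto elim!: eventually_mono)
  then show ?thesis using True by (simp add: emeasure_eq_measure)
next
  case False
  let ?E = "run_event T p w"
  define K where "K i = {t. t < T \<and> w t = i}" for i
  define S where "S = (\<Union>i\<in>J. K i)"
  define G where "G x = (\<Prod>i\<in>J. h i ((\<Sum>t\<in>K i. x t) / card (K i)))" for x :: "nat \<Rightarrow> real"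
  have pos: "0 < prob ?E" using False by (simp add: zero_less_measure_iff)
  have cancel: "ennreal (prob ?E) * (x / ennreal (prob ?E)) = x" for x
    using pos by (subst ennreal_times_divide, subst mult.commute, subst mult_divide_eq_ennreal) auto
  have fin: "finite J" using J finite_subset by blast
  have S: "S \<subseteq> {..<T}" by (auto simp: S_def K_def)
  have w: "w t \<in> good \<inter> set (user_group L A p a)" if "t \<in> S" for t using that J by (auto simp: S_def K_def)
  note [measurable] = h
  have Gm: "G \<in> borel_measurable (\<Pi>\<^sub>M t\<in>S. borel)"
    unfolding G_def
  proof (intro borel_measurable_prod_ennreal measurable_compose[OF _ h])
    fix i assume "i \<in> J"
    then have "t \<in> S" if "t \<in> K i" for t using that by (auto simp: S_def)
    then show "(\<lambda>x. (\<Sum>t\<in>K i. x t) / real (card (K i))) \<in> borel_measurable (\<Pi>\<^sub>M t\<in>S. borel)"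
      by (intro borel_measurable_divide borel_measurable_sum measurable_component_singleton) auto
  qed
  have on_E: "(\<Prod>i\<in>J. h i (user_mean user rew i T \<omega>)) * indicator ?E \<omega> = G (\<lambda>t\<in>S. rew t \<omega>) * indicator ?E \<omega>" for \<omega>
  proof (cases "\<omega> \<in> ?E")
    case True
    have "user_mean user rew i T \<omega> = (\<Sum>t\<in>K i. (\<lambda>t\<in>S. rew t \<omega>) t) / card (K i)" if "i \<in> J" for i
    proof -
      have "{s. s < T \<and> user s \<omega> = i} = K i" using True by (auto simp: K_def run_event_def)
      moreover have "K i \<subseteq> S" using that by (auto simp: S_def)
      ultimately show ?thesis by (auto simp: user_mean_def visits_def intro!: sum.cong)
    qed
    then show ?thesis by (simp add: G_def)
  qed simp
  have "(\<integral>\<^sup>+\<omega>. (\<Prod>i\<in>J. h i (user_mean user rew i T \<omega>)) * indicator ?E \<omega> \<partial>M)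
      = (\<integral>\<^sup>+\<omega>. G (\<lambda>t\<in>S. rew t \<omega>) * indicator ?E \<omega> \<partial>M)"
    by (simp only: on_E)
  also have "\<dots> = emeasure M ?E * (\<integral>\<^sup>+\<omega>. G (\<lambda>t\<in>S. rew t \<omega>) \<partial>uniform_measure M ?E)"
    using pos measurable_compose[OF _ Gm, of "\<lambda>\<omega>. \<lambda>t\<in>S. rew t \<omega>" M]
    by (subst nn_integral_uniform_measure) (auto simp: emeasure_eq_measure cancel)
  also have "(\<integral>\<^sup>+\<omega>. G (\<lambda>t\<in>S. rew t \<omega>) \<partial>uniform_measure M ?E)
      = (\<integral>\<^sup>+x. G x \<partial>distr (uniform_measure M ?E) (\<Pi>\<^sub>M t\<in>S. borel) (\<lambda>\<omega>. \<lambda>t\<in>S. rew t \<omega>))"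
    by (rule nn_integral_distr[symmetric], measurable) (simp add: Gm)
  also have "\<dots> = (\<integral>\<^sup>+x. G x \<partial>(\<Pi>\<^sub>M t\<in>S. R a))"
    by (subst distr_rewards_run_event[OF a S w pos]) auto
  also have "\<dots> = (\<Prod>i\<in>J. \<integral>\<^sup>+y. h i y \<partial>sample_mean_law (R a) (K i))"
    unfolding G_def S_def
    by (rule nn_integral_PiM_block_means[OF real_distribution_R[OF a] fin])
       (use assms(3) h in \<open>auto simp: K_def disjoint_family_on_def\<close>)
  finally show ?thesis by (simp add: K_def)
qed

end

section \<open>Chernoff bounds over a block of a random permutation\<close>

context grouped_bandit
begin

abbreviation emp_mean :: "nat \<Rightarrow> nat \<Rightarrow> 'a \<Rightarrow> real" where
  "emp_mean T i \<omega> \<equiv> user_mean user rew i T \<omega>"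

abbreviation mean_law :: "nat \<Rightarrow> (nat \<Rightarrow> nat) \<Rightarrow> nat \<Rightarrow> nat \<Rightarrow> real measure" where
  "mean_law T w a i \<equiv> sample_mean_law (R a) {t. t < T \<and> w t = i}"

lemma L_pos: "0 < L"
  using not_empty user_less[of _ 0] by fastforce

lemma seed_permutation: "\<omega> \<in> space M \<Longrightarrow> seed \<omega> \<in> permutations_of_set {..<L}"
  using grouping by (auto simp: random_grouping_def)

lemma block_end_le: "a < A \<Longrightarrow> Suc a * L div A \<le> L"
  using div_le_mono[OF mult_le_mono1[OF Suc_leI], of a A L A] A_pos by simp

lemma nth_mem_user_group:
  assumes "p \<in> permutations_of_set {..<L}" "a < A" "a * L div A \<le> k" "k < Suc a * L div A"
  shows "p ! k \<in> set (user_group L A p a)"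
proof -
  have "length p = L" using length_finite_permutations_of_set[OF assms(1)] by simp
  then have "user_group L A p a ! (k - a * L div A) = p ! k"
      "k - a * L div A < length (user_group L A p a)"
    using assms(3,4) block_end_le[OF assms(2)] unfolding user_group_def by simp_all
  then show ?thesis by (metis nth_mem)
qed

text \<open>The seed has a countable type, so it is enough to know measurability for every fixed
  seed.\<close>

lemma seed_compose_measurable:
  assumes "\<And>p. F p \<in> M \<rightarrow>\<^sub>M N"
  shows "(\<lambda>\<omega>. F (seed \<omega>) \<omega>) \<in> M \<rightarrow>\<^sub>M N"
  using assms seed_measurable by (rule measurable_compose_countable)

lemma block_sum_measurable:
  fixes \<phi> :: "nat \<Rightarrow> real \<Rightarrow> real"
  assumes "\<And>i. \<phi> i \<in> borel_measurable borel"
  shows "(\<lambda>\<omega>. \<Sum>k\<in>K. \<phi> (seed \<omega> ! k) (emp_mean T (seed \<omega> ! k) \<omega>)) \<in> borel_measurable M"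
proof (rule seed_compose_measurable)
  show "(\<lambda>\<omega>. \<Sum>k\<in>K. \<phi> (p ! k) (emp_mean T (p ! k) \<omega>)) \<in> borel_measurable M" for p
    by (intro borel_measurable_sum measurable_compose[OF user_mean_measurable assms])
qed

text \<open>Chernoff's method on one run. The factors of adversarial users are first replaced by the
  constants \<open>g i\<close>, whatever their rewards are; only then is independence used, and only
  for good users. This is why the adversary may react to good rewards.\<close>

lemma prob_block_sum_run_event:
  fixes \<phi> :: "nat \<Rightarrow> real \<Rightarrow> real" and g :: "nat \<Rightarrow> real"
  assumes p: "p \<in> permutations_of_set {..<L}"
    and a: "a < A" and blk: "a * L div A \<le> s" "s + N \<le> Suc a * L div A"
    and visited: "\<And>i. i < L \<Longrightarrow> {t. t < T \<and> w t = i} \<noteq> {}"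
    and \<phi>: "\<And>i. \<phi> i \<in> borel_measurable borel"
    and bad: "\<And>i y. i < L \<Longrightarrow> i \<notin> good \<Longrightarrow> exp (\<phi> i y) \<le> g i"
    and g: "\<And>i. i \<in> good \<Longrightarrow> (\<integral>\<^sup>+y. ennreal (exp (\<phi> i y)) \<partial>mean_law T w a i) \<le> ennreal (g i)"
    and g0: "\<And>i. i < L \<Longrightarrow> 0 \<le> g i"
  shows "prob {\<omega>\<in>run_event T p w. c \<le> (\<Sum>k\<in>{s..<s + N}. \<phi> (p ! k) (emp_mean T (p ! k) \<omega>))}
    \<le> prob (run_event T p w) * (exp (- c) * (\<Prod>k\<in>{s..<s + N}. g (p ! k)))"
proof -
  let ?E = "run_event T p w"
  define I where "I = (!) p ` {s..<s + N}"
  have len: "length p = L" "distinct p" "set p = {..<L}"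
    using p length_finite_permutations_of_set[OF p] by (auto simp: permutations_of_set_def)
  have inj: "inj_on ((!) p) {s..<s + N}"
    using blk block_end_le[OF a] len by (auto simp: inj_on_def nth_eq_iff_index_eq)
  have I: "finite I" "I \<subseteq> set (user_group L A p a)" "I \<subseteq> {..<L}"
    using blk block_end_le[OF a] nth_mem_user_group[OF p a] len nth_mem[of _ p]
    by (auto simp: I_def)
  define h where "h i y = ennreal (exp (\<phi> i y))" for i y
  have hm [measurable]: "h i \<in> borel_measurable borel" for i
    using \<phi>[of i] unfolding h_def by simp
  have "emeasure M {\<omega>\<in>?E. c \<le> (\<Sum>k\<in>{s..<s + N}. \<phi> (p ! k) (emp_mean T (p ! k) \<omega>))}
      = (\<integral>\<^sup>+\<omega>. indicator {\<omega>\<in>?E. c \<le> (\<Sum>k\<in>{s..<s + N}. \<phi> (p ! k) (emp_mean T (p ! k) \<omega>))} \<omega> \<partial>M)"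
  proof (rule nn_integral_indicator[symmetric])
    have "(\<lambda>\<omega>. \<Sum>k\<in>{s..<s + N}. \<phi> (p ! k) (emp_mean T (p ! k) \<omega>)) \<in> borel_measurable M"
      by (intro borel_measurable_sum measurable_compose[OF user_mean_measurable \<phi>])
    then have "{\<omega>\<in>space M. c \<le> (\<Sum>k\<in>{s..<s + N}. \<phi> (p ! k) (emp_mean T (p ! k) \<omega>))} \<in> sets M" by measurable
    moreover have "{\<omega>\<in>?E. c \<le> (\<Sum>k\<in>{s..<s + N}. \<phi> (p ! k) (emp_mean T (p ! k) \<omega>))}
        = ?E \<inter> {\<omega>\<in>space M. c \<le> (\<Sum>k\<in>{s..<s + N}. \<phi> (p ! k) (emp_mean T (p ! k) \<omega>))}"
      by (auto simp: run_event_def)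
    ultimately show "{\<omega>\<in>?E. c \<le> (\<Sum>k\<in>{s..<s + N}. \<phi> (p ! k) (emp_mean T (p ! k) \<omega>))} \<in> sets M" by simp
  qed
  also have "\<dots> \<le> (\<integral>\<^sup>+\<omega>. ennreal (exp (- c) * (\<Prod>i\<in>I - good. g i)) *
      ((\<Prod>i\<in>I \<inter> good. h i (emp_mean T i \<omega>)) * indicator ?E \<omega>) \<partial>M)"
  proof (intro nn_integral_mono)
    fix \<omega>
    show "indicator {\<omega>\<in>?E. c \<le> (\<Sum>k\<in>{s..<s + N}. \<phi> (p ! k) (emp_mean T (p ! k) \<omega>))} \<omega>
      \<le> ennreal (exp (- c) * (\<Prod>i\<in>I - good. g i)) * ((\<Prod>i\<in>I \<inter> good. h i (emp_mean T i \<omega>)) * indicator ?E \<omega>)"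
    proof (cases "\<omega> \<in> ?E \<and> c \<le> (\<Sum>k\<in>{s..<s + N}. \<phi> (p ! k) (emp_mean T (p ! k) \<omega>))")
      case True
      then have "c \<le> (\<Sum>i\<in>I. \<phi> i (emp_mean T i \<omega>))" using inj by (simp add: I_def sum.reindex)
      then have "1 \<le> exp (- c) * exp (\<Sum>i\<in>I. \<phi> i (emp_mean T i \<omega>))" by (simp flip: exp_add)
      also have "exp (\<Sum>i\<in>I. \<phi> i (emp_mean T i \<omega>)) = (\<Prod>i\<in>I \<inter> good. exp (\<phi> i (emp_mean T i \<omega>))) * (\<Prod>i\<in>I - good. exp (\<phi> i (emp_mean T i \<omega>)))"
        using I by (simp add: exp_sum prod.Int_Diff[of I _ good])
      also have "\<dots> \<le> (\<Prod>i\<in>I \<inter> good. exp (\<phi> i (emp_mean T i \<omega>))) * (\<Prod>i\<in>I - good. g i)"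
        using I bad by (intro mult_left_mono prod_mono prod_nonneg) auto
      finally have "1 \<le> exp (- c) * (\<Prod>i\<in>I - good. g i) * (\<Prod>i\<in>I \<inter> good. exp (\<phi> i (emp_mean T i \<omega>)))"
        by (simp add: mult_ac)
      then have "ennreal 1 \<le> ennreal (exp (- c) * (\<Prod>i\<in>I - good. g i) * (\<Prod>i\<in>I \<inter> good. exp (\<phi> i (emp_mean T i \<omega>))))"
        by (rule ennreal_leI)
      also have "\<dots> = ennreal (exp (- c) * (\<Prod>i\<in>I - good. g i)) * (\<Prod>i\<in>I \<inter> good. h i (emp_mean T i \<omega>))"
        using I g0 by (subst ennreal_mult) (auto simp: h_def prod_ennreal intro!: mult_nonneg_nonneg prod_nonneg)
      finally show ?thesis using True by simp
    qed auto
  qed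
  also have "\<dots> = ennreal (exp (- c) * (\<Prod>i\<in>I - good. g i)) *
      (\<integral>\<^sup>+\<omega>. (\<Prod>i\<in>I \<inter> good. h i (emp_mean T i \<omega>)) * indicator ?E \<omega> \<partial>M)"
    by (intro nn_integral_cmult borel_measurable_times_ennreal borel_measurable_prod_ennreal
        measurable_compose[OF user_mean_measurable hm] borel_measurable_indicator run_event_sets)
  also have "\<dots> \<le> ennreal (exp (- c) * (\<Prod>i\<in>I - good. g i)) * ennreal (prob ?E * (\<Prod>i\<in>I \<inter> good. g i))"
  proof (rule mult_left_mono)
    have "(\<integral>\<^sup>+\<omega>. (\<Prod>i\<in>I \<inter> good. h i (emp_mean T i \<omega>)) * indicator ?E \<omega> \<partial>M)
        = emeasure M ?E * (\<Prod>i\<in>I \<inter> good. \<integral>\<^sup>+y. h i y \<partial>mean_law T w a i)"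
      using I visited by (intro nn_integral_user_means[OF a] hm) auto
    also have "\<dots> \<le> emeasure M ?E * (\<Prod>i\<in>I \<inter> good. ennreal (g i))"
      using g by (intro mult_left_mono prod_mono_ennreal) (auto simp: h_def[abs_def])
    also have "(\<Prod>i\<in>I \<inter> good. ennreal (g i)) = ennreal (\<Prod>i\<in>I \<inter> good. g i)"
      using I g0 by (intro prod_ennreal) auto
    also have "emeasure M ?E * \<dots> = ennreal (prob ?E * (\<Prod>i\<in>I \<inter> good. g i))"
      unfolding emeasure_eq_measure using I g0 by (intro ennreal_mult[symmetric] prod_nonneg) auto
    finally show "(\<integral>\<^sup>+\<omega>. (\<Prod>i\<in>I \<inter> good. h i (emp_mean T i \<omega>)) * indicator ?E \<omega> \<partial>M)
        \<le> ennreal (prob ?E * (\<Prod>i\<in>I \<inter> good. g i))" .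
  qed simp
  also have "\<dots> = ennreal (exp (- c) * (\<Prod>i\<in>I - good. g i) * (prob ?E * (\<Prod>i\<in>I \<inter> good. g i)))"
    using I g0 by (intro ennreal_mult[symmetric] mult_nonneg_nonneg prod_nonneg) auto
  also have "exp (- c) * (\<Prod>i\<in>I - good. g i) * (prob ?E * (\<Prod>i\<in>I \<inter> good. g i))
      = prob ?E * (exp (- c) * (\<Prod>i\<in>I. g i))"
    using I by (simp add: prod.Int_Diff[of I _ good] mult_ac)
  also have "(\<Prod>i\<in>I. g i) = (\<Prod>k\<in>{s..<s + N}. g (p ! k))"
    using inj by (simp add: I_def prod.reindex)
  finally have le: "ennreal (prob {\<omega>\<in>?E. c \<le> (\<Sum>k\<in>{s..<s + N}. \<phi> (p ! k) (emp_mean T (p ! k) \<omega>))})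
      \<le> ennreal (prob ?E * (exp (- c) * (\<Prod>k\<in>{s..<s + N}. g (p ! k))))"
    by (simp only: emeasure_eq_measure)
  have "0 \<le> (\<Prod>k\<in>{s..<s + N}. g (p ! k))"
    using g0 I(3) by (intro prod_nonneg) (auto simp: I_def image_subset_iff)
  then show ?thesis using le by (subst (asm) ennreal_le_iff) auto
qed

text \<open>Given the arrivals all seeds have equal weight, so the product of \<open>g\<close> over
  the block is averaged over permutations. Sampling without replacement gives at most the
  \<open>N\<close>-th power of the overall mean of \<open>g\<close>, and this mean is at most
  \<open>1 + r \<le> exp r\<close>.\<close>

lemma prob_block_sum:
  fixes \<phi> :: "nat \<Rightarrow> real \<Rightarrow> real" and g :: "nat \<Rightarrow> real" and r :: real
  assumes a: "a < A" and blk: "a * L div A \<le> s" "s + N \<le> Suc a * L div A"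
    and visited: "\<And>i. i < L \<Longrightarrow> {t. t < T \<and> w t = i} \<noteq> {}"
    and \<phi>: "\<And>i. \<phi> i \<in> borel_measurable borel"
    and bad: "\<And>i y. i < L \<Longrightarrow> i \<notin> good \<Longrightarrow> exp (\<phi> i y) \<le> g i"
    and g: "\<And>i. i \<in> good \<Longrightarrow> (\<integral>\<^sup>+y. ennreal (exp (\<phi> i y)) \<partial>mean_law T w a i) \<le> ennreal (g i)"
    and g0: "\<And>i. i < L \<Longrightarrow> 0 \<le> g i"
    and sum: "(\<Sum>i<L. g i) \<le> L * (1 + r)"
  shows "prob {\<omega>\<in>arrival_event T w. c \<le> (\<Sum>k\<in>{s..<s + N}. \<phi> (seed \<omega> ! k) (emp_mean T (seed \<omega> ! k) \<omega>))}
    \<le> prob (arrival_event T w) * exp (N * r - c)"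
proof -
  let ?P = "permutations_of_set {..<L}"
  define X where "X p = {\<omega>\<in>run_event T p w. c \<le> (\<Sum>k\<in>{s..<s + N}. \<phi> (p ! k) (emp_mean T (p ! k) \<omega>))}" for p
  have X: "X p \<in> sets M" for p
  proof -
    have "(\<lambda>\<omega>. \<Sum>k\<in>{s..<s + N}. \<phi> (p ! k) (emp_mean T (p ! k) \<omega>)) \<in> borel_measurable M"
      by (intro borel_measurable_sum measurable_compose[OF user_mean_measurable \<phi>])
    then have "{\<omega>\<in>space M. c \<le> (\<Sum>k\<in>{s..<s + N}. \<phi> (p ! k) (emp_mean T (p ! k) \<omega>))} \<in> sets M" by measurable
    moreover have "X p = run_event T p w \<inter> {\<omega>\<in>space M. c \<le> (\<Sum>k\<in>{s..<s + N}. \<phi> (p ! k) (emp_mean T (p ! k) \<omega>))}"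
      by (auto simp: X_def run_event_def)
    ultimately show ?thesis by simp
  qed
  have "{\<omega>\<in>arrival_event T w. c \<le> (\<Sum>k\<in>{s..<s + N}. \<phi> (seed \<omega> ! k) (emp_mean T (seed \<omega> ! k) \<omega>))} \<subseteq> (\<Union>p\<in>?P. X p)"
    using seed_permutation by (auto simp: arrival_event_def X_def run_event_def)
  then have "prob {\<omega>\<in>arrival_event T w. c \<le> (\<Sum>k\<in>{s..<s + N}. \<phi> (seed \<omega> ! k) (emp_mean T (seed \<omega> ! k) \<omega>))}
      \<le> prob (\<Union>p\<in>?P. X p)"
    using X by (intro finite_measure_mono) auto
  also have "\<dots> \<le> (\<Sum>p\<in>?P. prob (X p))"
    using X by (intro finite_measure_subadditive_finite) auto
  also have "\<dots> \<le> (\<Sum>p\<in>?P. prob (arrival_event T w) / fact L * (exp (- c) * (\<Prod>k\<in>{s..<s + N}. g (p ! k))))"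
    using prob_block_sum_run_event[OF _ a blk visited \<phi> bad g g0]
    by (intro sum_mono) (simp add: X_def prob_run_event[symmetric])
  also have "\<dots> = prob (arrival_event T w) / fact L * exp (- c) * (\<Sum>p\<in>?P. \<Prod>k\<in>{s..<s + N}. g (p ! k))"
    by (simp add: sum_distrib_left mult_ac)
  also have "\<dots> \<le> prob (arrival_event T w) / fact L * exp (- c) * (fact L * exp (N * r))"
  proof (intro mult_left_mono)
    have "(\<Sum>p\<in>?P. \<Prod>k\<in>{s..<s + N}. g (p ! k)) \<le> fact L * ((\<Sum>i<L. g i) / L) ^ N"
      using sum_permutations_prod_block_le[of "{..<L}" g s N] g0 blk block_end_le[OF a] by simp
    also have "\<dots> \<le> fact L * exp r ^ N"
    proof (intro mult_left_mono power_mono)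
      have "(\<Sum>i<L. g i) / L \<le> 1 + r" using sum L_pos by (simp add: divide_simps mult.commute)
      also have "\<dots> \<le> exp r" by (rule exp_ge_add_one_self)
      finally show "(\<Sum>i<L. g i) / L \<le> exp r" .
      show "0 \<le> (\<Sum>i<L. g i) / L" using g0 by (intro divide_nonneg_nonneg sum_nonneg) auto
    qed auto
    finally show "(\<Sum>p\<in>?P. \<Prod>k\<in>{s..<s + N}. g (p ! k)) \<le> fact L * exp (N * r)"
      by (simp add: exp_of_nat_mult)
  qed auto
  also have "\<dots> = prob (arrival_event T w) * exp (N * r - c)"
    by (simp add: exp_diff exp_minus field_simps)
  finally show ?thesis .
qed

text \<open>The exponent is \<open>\<theta>\<close> times an indicator: positive
  \<open>\<theta>\<close> yields upper tails, negative \<open>\<theta>\<close> lower tails. For an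
  adversarial user \<open>mean_law\<close> is only a formal law, unrelated to the true rewards; but
  the indicator is constant there, so the measure 0 or 1 of \<open>B i\<close> is the right
  value.\<close>

lemma prob_block_count:
  fixes B :: "nat \<Rightarrow> real set" and \<theta> \<rho> :: real
  assumes a: "a < A" and blk: "a * L div A \<le> s" "s + N \<le> Suc a * L div A"
    and visited: "\<And>i. i < L \<Longrightarrow> {t. t < T \<and> w t = i} \<noteq> {}"
    and B: "\<And>i. B i \<in> sets borel"
    and bad: "\<And>i. i < L \<Longrightarrow> i \<notin> good \<Longrightarrow> B i = {} \<or> B i = UNIV"
    and sum: "(exp \<theta> - 1) * (\<Sum>i<L. measure (mean_law T w a i) (B i)) \<le> \<rho> * L"
  shows "prob {\<omega>\<in>arrival_event T w. c \<le> \<theta> * card {k\<in>{s..<s + N}. emp_mean T (seed \<omega> ! k) \<omega> \<in> B (seed \<omega> ! k)}}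
    \<le> prob (arrival_event T w) * exp (N * \<rho> - c)"
proof -
  define g where "g i = 1 + (exp \<theta> - 1) * measure (mean_law T w a i) (B i)" for i
  have law: "real_distribution (mean_law T w a i)" for i
    by (rule real_distribution_sample_mean_law[OF real_distribution_R[OF a]])
  have "0 \<le> g i" for i
  proof -
    interpret N: real_distribution "mean_law T w a i" by (rule law)
    \<comment> \<open>A convex combination of 1 and \<open>exp \<theta>\<close> is nonnegative for
      either sign of \<open>\<theta>\<close>.\<close>
    have "0 \<le> (1 - N.prob (B i)) + exp \<theta> * N.prob (B i)" by simp
    then show ?thesis by (simp add: g_def algebra_simps)
  qed
  moreover have "exp (\<theta> * indicator (B i) y) \<le> g i" if "i < L" "i \<notin> good" for i y
  proof -
    interpret N: real_distribution "mean_law T w a i" by (rule law)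
    show ?thesis using bad[OF that] N.prob_space by (auto simp: g_def)
  qed
  moreover have "(\<integral>\<^sup>+y. ennreal (exp (\<theta> * indicator (B i) y)) \<partial>mean_law T w a i) \<le> ennreal (g i)" for i
    using real_distribution.nn_integral_exp_indicator[OF law B] by (simp add: g_def)
  moreover have "(\<Sum>i<L. g i) \<le> L * (1 + \<rho>)"
    unfolding g_def sum.distrib sum_distrib_left[symmetric] using sum by (simp add: distrib_left mult.commute)
  moreover have "(\<lambda>y. \<theta> * indicator (B i) y) \<in> borel_measurable borel" for i using B by simp
  ultimately have "prob {\<omega>\<in>arrival_event T w. c \<le> (\<Sum>k\<in>{s..<s + N}. \<theta> * indicator (B (seed \<omega> ! k)) (emp_mean T (seed \<omega> ! k) \<omega>))}
      \<le> prob (arrival_event T w) * exp (N * \<rho> - c)"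
    by (intro prob_block_sum[OF a blk visited, where g=g]) auto
  moreover have "(\<Sum>k\<in>{s..<s + N}. \<theta> * indicator (B (seed \<omega> ! k)) (emp_mean T (seed \<omega> ! k) \<omega>))
      = \<theta> * card {k\<in>{s..<s + N}. emp_mean T (seed \<omega> ! k) \<omega> \<in> B (seed \<omega> ! k)}" for \<omega>
    by (simp add: sum_distrib_left[symmetric] indicator_def sum.If_cases Int_def)
  ultimately show ?thesis by simp
qed

end

section \<open>Deviation of one arm\<close>

lemma card_shift_segment:
  fixes P :: "nat \<Rightarrow> bool"
  shows "card {k\<in>{x..<x + N}. P (d + k)} = card {k\<in>{d + x..<d + x + N}. P k}"
proof -
  have "(+) d ` {k\<in>{x..<x + N}. P (d + k)} = {k\<in>{d + x..<d + x + N}. P k}"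
  proof (intro equalityI subsetI)
    fix k assume "k \<in> {k\<in>{d + x..<d + x + N}. P k}"
    then show "k \<in> (+) d ` {k\<in>{x..<x + N}. P (d + k)}" by (intro image_eqI[of _ _ "k - d"]) auto
  qed auto
  moreover have "card ((+) d ` {k\<in>{x..<x + N}. P (d + k)}) = card {k\<in>{x..<x + N}. P (d + k)}"
    by (rule card_image) (rule inj_on_add)
  ultimately show ?thesis by (simp only:)
qed

text \<open>The order statistic is at most \<open>x\<close> exactly when more than \<open>j\<close>
  of the variables are, which is a condition on a finite sum of indicators.\<close>

lemma order_stat_measurable:
  fixes Z :: "'i \<Rightarrow> 'w \<Rightarrow> real"
  assumes Z: "\<And>i. Z i \<in> borel_measurable M" and q: "q \<le> 1" and ne: "is \<noteq> []"
  shows "(\<lambda>\<omega>. order_stat (map (\<lambda>i. Z i \<omega>) is) q) \<in> borel_measurable M"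
proof (rule borel_measurable_iff_le[THEN iffD2], intro allI)
  fix x
  define j where "j = nat \<lceil>q * real (length is)\<rceil> - 1"
  have "q * real (length is) \<le> real (length is)" using mult_right_mono[OF q, of "real (length is)"] by simp
  then have "nat \<lceil>q * real (length is)\<rceil> \<le> length is" by (simp add: ceiling_le_iff)
  moreover have "0 < length is" using ne by simp
  ultimately have j: "j < length is" unfolding j_def by linarith
  have os: "order_stat (map (\<lambda>i. Z i \<omega>) is) q = sort (map (\<lambda>i. Z i \<omega>) is) ! j" for \<omega>
    by (simp add: order_stat_def j_def)
  have "order_stat (map (\<lambda>i. Z i \<omega>) is) q \<le> x
      \<longleftrightarrow> real j < (\<Sum>k<length is. if Z (is ! k) \<omega> \<le> x then 1 else 0)" for \<omega>
    using sort_nth_le_iff(1)[of j "map (\<lambda>i. Z i \<omega>) is" x] j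
    by (simp add: os length_filter_conv_card sum.If_cases Int_def cong: conj_cong)
  moreover have "{\<omega>\<in>space M. real j < (\<Sum>k<length is. if Z (is ! k) \<omega> \<le> x then 1 else 0)} \<in> sets M"
    using Z by measurable
  ultimately show "{\<omega>\<in>space M. order_stat (map (\<lambda>i. Z i \<omega>) is) q \<le> x} \<in> sets M" by simp
qed

lemma trimmed_mean_measurable:
  fixes Z :: "'i \<Rightarrow> 'w \<Rightarrow> real"
  assumes Z: "\<And>i. Z i \<in> borel_measurable M" and \<kappa>: "0 \<le> trim_level \<eta> \<delta> (length is div 2)"
  shows "(\<lambda>\<omega>. trimmed_mean \<eta> \<delta> (map (\<lambda>i. Z i \<omega>) is)) \<in> borel_measurable M"
\<comment> \<open>With empty halves the division by 0 makes the estimate constantly 0.\<close>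
proof (cases "length is div 2 = 0")
  case True
  then show ?thesis by (simp add: trimmed_mean_def Let_def)
next
  case False
  define N where "N = length is div 2"
  define \<kappa> where "\<kappa> = trim_level \<eta> \<delta> N"
  define ys where "ys = take N (drop N is)"
  have ys: "ys \<noteq> []" using False by (auto simp: ys_def N_def)
  have "\<kappa> \<le> 5 / 12" unfolding \<kappa>_def trim_level_def by (rule min.cobounded1)
  then have k: "\<kappa> \<le> 1" "1 - \<kappa> \<le> 1" using assms(2) by (simp_all add: \<kappa>_def N_def)
  note [measurable] = order_stat_measurable[where Z=Z, OF Z k(1) ys] order_stat_measurable[where Z=Z, OF Z k(2) ys] Z
  have "trimmed_mean \<eta> \<delta> (map (\<lambda>i. Z i \<omega>) is)
      = (\<Sum>k<N. clip (order_stat (map (\<lambda>i. Z i \<omega>) ys) \<kappa>) (order_stat (map (\<lambda>i. Z i \<omega>) ys) (1 - \<kappa>)) (Z (is ! k) \<omega>)) / N" for \<omega>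
    by (simp add: trimmed_mean_def Let_def N_def[symmetric] \<kappa>_def[symmetric] ys_def take_map drop_map
        sum_list_sum_nth atLeast0LessThan) (simp add: N_def)
  then show ?thesis unfolding clip_def by simp
qed

context grouped_bandit
begin

section \<open>Groups and the moments of user means\<close>

lemma length_user_group:
  assumes "p \<in> permutations_of_set {..<L}" "a < A"
  shows "length (user_group L A p a) = Suc a * L div A - a * L div A"
  using length_finite_permutations_of_set[OF assms(1)] block_end_le[OF assms(2)]
  by (simp add: user_group_def min_def)

lemma nth_user_group:
  assumes "p \<in> permutations_of_set {..<L}" "a < A" "k < Suc a * L div A - a * L div A"
  shows "user_group L A p a ! k = p ! (a * L div A + k)"
  using length_finite_permutations_of_set[OF assms(1)] block_end_le[OF assms(2)] assms(3)
  unfolding user_group_def by simp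

lemma mean_law_real_distribution:
  assumes "a < A"
  shows "real_distribution (mean_law T w a i)"
  by (rule real_distribution_sample_mean_law[OF real_distribution_R[OF assms]])

lemma sum_not_good_le: "(\<Sum>i<L. if i \<in> good then 0 else 1) \<le> \<alpha> * L"
proof -
  have "real (card ({..<L} - good)) = real L - real (card good)"
    using good_users(1) by (subst card_Diff_subset) (auto simp: finite_subset of_nat_diff card_mono[of "{..<L}", simplified])
  moreover have "(\<Sum>i<L. if i \<in> good then 0 else 1) = real (card ({..<L} - good))"
    by (simp add: sum.If_cases set_diff_eq Int_def)
  ultimately show ?thesis using good_users(2) by (simp add: algebra_simps)
qed

text \<open>The hypothesis bounds the reciprocal of the number of visits by \<open>v\<close> in
  product form, so it also excludes a user without visits before \<open>T\<close>.\<close>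

lemma mean_law_moments:
  fixes v :: real
  assumes a: "a < A" and v: "1 \<le> v * card {t. t < T \<and> w t = i}"
  shows "integrable (mean_law T w a i) (\<lambda>y. (y - \<mu> a)\<^sup>2)" "(\<integral>y. (y - \<mu> a)\<^sup>2 \<partial>mean_law T w a i) \<le> v"
    "integrable (mean_law T w a i) (\<lambda>y. y - \<mu> a)" "(\<integral>y. y - \<mu> a \<partial>mean_law T w a i) = 0"
proof -
  have ne: "{t. t < T \<and> w t = i} \<noteq> {}" using v by (metis card.empty mult_zero_right not_one_le_zero of_nat_0)
  note m = sample_mean_law_moments[OF real_distribution_R[OF a] _ ne reward_square_integrable[OF a] reward_mean[OF a]]
  show "integrable (mean_law T w a i) (\<lambda>y. (y - \<mu> a)\<^sup>2)" "integrable (mean_law T w a i) (\<lambda>y. y - \<mu> a)"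
    "(\<integral>y. y - \<mu> a \<partial>mean_law T w a i) = 0"
    using m by simp_all
  have "0 < card {t. t < T \<and> w t = i}" using ne by (simp add: card_gt_0_iff)
  then have "1 / card {t. t < T \<and> w t = i} \<le> v" using v by (simp add: divide_simps)
  moreover have "(\<integral>x. (x - \<mu> a)\<^sup>2 \<partial>R a) / card {t. t < T \<and> w t = i} \<le> 1 / card {t. t < T \<and> w t = i}"
    using reward_variance[OF a] by (intro divide_right_mono) auto
  ultimately show "(\<integral>y. (y - \<mu> a)\<^sup>2 \<partial>mean_law T w a i) \<le> v" using m(2) by simp
qed

text \<open>Outside eight exceptional events, each of probability at most that of the arrival event
  times \<open>exp (- (\<kappa> * N / 1000))\<close>, the hypotheses of
  \<open>trimmed_mean_deviation\<close> hold. The choice of \<open>s\<close> makes the Chebyshev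
  bound \<open>v / s\<^sup>2\<close> equal to \<open>\<kappa> / 10\<close>; together with
  \<open>\<alpha> \<le> 4 / 5 * \<kappa>\<close>, the mean share of adversarial or far points is at
  most \<open>9 / 10 * \<kappa>\<close>.\<close>

lemma arm_estimate_deviation:
  fixes \<kappa> s v :: real and N :: nat
  assumes a: "a < A" and \<alpha>: "\<alpha> < 1 / 3"
    and N: "N = (Suc a * L div A - a * L div A) div 2" "0 < N"
    and \<kappa>: "\<kappa> = trim_level \<alpha> (1 / (10 * real A)) N" "0 < \<kappa>" "\<alpha> \<le> 4 / 5 * \<kappa>"
    and s: "0 < s" "s\<^sup>2 * \<kappa> = 10 * v"
    and visits: "\<And>i. i < L \<Longrightarrow> 1 \<le> v * card {t. t < T \<and> w t = i}"
  shows "prob {\<omega>\<in>arrival_event T w. \<not> \<bar>arm_estimate L A \<alpha> seed user rew T a \<omega> - \<mu> a\<bar> \<le> 14 * s * \<kappa>}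
    \<le> prob (arrival_event T w) * (8 * exp (- (\<kappa> * N / 1000)))"
proof -
  define d where "d = a * L div A"
  let ?law = "mean_law T w a"
  define S1 S2 where "S1 = {d..<d + N}" and "S2 = {d + N..<d + N + N}"
  have \<kappa>12: "\<kappa> \<le> 5 / 12" unfolding \<kappa>(1) trim_level_def by (rule min.cobounded1)
  have blk: "a * L div A \<le> d" "d + N \<le> Suc a * L div A"
      "a * L div A \<le> d + N" "d + N + N \<le> Suc a * L div A"
    using N by (auto simp: d_def)
  have visited: "{t. t < T \<and> w t = i} \<noteq> {}" if "i < L" for i
    using visits[OF that] by (metis card.empty mult_zero_right not_one_le_zero of_nat_0)
  have law: "real_distribution (?law i)" for i by (rule mean_law_real_distribution[OF a])
  have prob_law: "measure (?law i) UNIV = 1" for i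
  proof -
    interpret N: real_distribution "?law i" by (rule law)
    show ?thesis using N.prob_space by simp
  qed
  have good: "finite good" "good \<subseteq> {..<L}" using good_users(1) finite_subset by auto
  have sum_good: "(\<Sum>i<L. measure (?law i) (if i \<in> good then B else {})) = (\<Sum>i\<in>good. measure (?law i) B)" for B
    using good(2) by (simp add: if_distrib[of "measure _"] sum.If_cases Int_absorb1 cong: if_cong)
  define q where "q = 3 / 2 * \<kappa> * L"
    \<comment> \<open>\<open>3 \<kappa> / 2 \<le> 5 / 8\<close> is less than the proportion of good users, which exceeds \<open>2 / 3\<close>\<close>
  have q: "0 < q" "q < card good"
  proof -
    have "(1 - \<alpha>) * L > q" using \<kappa>12 \<alpha> L_pos by (simp add: q_def)
    then show "q < card good" using good_users(2) by linarith
  qed (use \<kappa> L_pos in \<open>simp add: q_def\<close>)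
  obtain q1 where q1: "(\<Sum>i\<in>good. measure (?law i) {..<q1}) \<le> q" "q \<le> (\<Sum>i\<in>good. measure (?law i) {..q1})"
    using exists_common_quantile[of good ?law q] good(1) law q by blast
  obtain q2 where q2: "(\<Sum>i\<in>good. measure (?law i) {q2<..}) \<le> q" "q \<le> (\<Sum>i\<in>good. measure (?law i) {q2..})"
    using exists_common_upper_quantile[of good ?law q] good(1) law q by blast

  \<comment> \<open>Adversarial users always count in \<open>far\<close>, never in
    \<open>only\<close>, and contribute 0 to \<open>mid\<close>. So none of these depends on their
    rewards, as the Chernoff bounds require.\<close>
  define far where "far i = (if i \<in> good then {y. s < \<bar>y - \<mu> a\<bar>} else UNIV)" for i
  define only where "only B i = (if i \<in> good then B else {})" for B :: "real set" and i :: nat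
  define mid where "mid \<tau> i y = (if i \<in> good then \<tau> * clip (- s) s (y - \<mu> a) / s else 0)" for \<tau> :: real and i :: nat and y
  define count where "count K B \<omega> = real (card {k\<in>K. emp_mean T (seed \<omega> ! k) \<omega> \<in> B (seed \<omega> ! k)})"
    for K :: "nat set" and B :: "nat \<Rightarrow> real set" and \<omega>
  define total where "total \<tau> \<omega> = (\<Sum>k\<in>S1. mid \<tau> (seed \<omega> ! k) (emp_mean T (seed \<omega> ! k) \<omega>))" for \<tau> \<omega>
  let ?E = "arrival_event T w" and ?e = "exp (- (\<kappa> * N / 1000))"

  \<comment> \<open>The counts use \<open>\<theta> = 1 / 10\<close> or
    \<open>\<theta> = - (1 / 10)\<close>. The tightest exponent belongs to \<open>far\<close>:
    \<open>11 / 100 * 9 / 10 - 1 / 10 = - 1 / 1000\<close> per unit of \<open>\<kappa> * N\<close>,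
    which fixes the rate in \<open>?e\<close>.\<close>
  have exps: "exp (1 / 10) - 1 \<le> (11 / 100 :: real)" "exp (- (1 / 10)) - 1 \<le> (- 9 / 100 :: real)" "0 \<le> exp (1 / 10) - (1 :: real)"
    using exp_le_quadratic[of "1 / 10"] exp_le_quadratic[of "- (1 / 10)"] exp_ge_add_one_self[of "1 / 10"]
    by (simp_all add: power2_eq_square)
  have \<kappa>N: "0 \<le> \<kappa> * N" "0 \<le> \<kappa> * L" using \<kappa> by simp_all

  \<comment> \<open>Exponential bounds for the exceptional events\<close>
  have far_sum: "(\<Sum>i<L. measure (?law i) (far i)) \<le> 9 / 10 * \<kappa> * L"
  proof -
    have "measure (?law i) (far i) \<le> \<kappa> / 10 + (if i \<in> good then 0 else 1)" if "i < L" for i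
    proof (cases "i \<in> good")
      case True
      have vs: "v / s\<^sup>2 = \<kappa> / 10" using s by (simp add: field_simps)
      then show ?thesis
        using real_distribution.prob_deviation_le[OF law s(1) mean_law_moments(1,2)[OF a visits[OF that]], unfolded vs] True
        by (simp add: far_def)
    qed (use \<kappa> prob_law in \<open>simp add: far_def\<close>)
    then have "(\<Sum>i<L. measure (?law i) (far i)) \<le> (\<Sum>i<L. \<kappa> / 10 + (if i \<in> good then 0 else 1))"
      by (intro sum_mono) auto
    also have "\<dots> \<le> \<kappa> / 10 * L + \<alpha> * L"
      using sum_not_good_le by (simp add: sum.distrib mult.commute)
    also have "\<dots> \<le> 9 / 10 * \<kappa> * L"
      using mult_right_mono[OF \<kappa>(3), of "real L"] by simp
    finally show ?thesis .
  qed
  have far_sets: "far i \<in> sets borel" for i by (simp add: far_def)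
  have far_prob: "prob {\<omega>\<in>?E. \<kappa> * N \<le> count K far \<omega>} \<le> prob ?E * ?e" if "K = S1 \<or> K = S2" for K
  proof -
    obtain e where e: "K = {e..<e + N}" "a * L div A \<le> e" "e + N \<le> Suc a * L div A"
      using \<open>K = S1 \<or> K = S2\<close> blk unfolding S1_def S2_def by blast
    have "(exp (1 / 10) - 1) * (\<Sum>i<L. measure (?law i) (far i)) \<le> 11 / 100 * (9 / 10 * \<kappa> * L)"
      using exps far_sum by (intro mult_mono) (auto intro: sum_nonneg)
    then have sum: "(exp (1 / 10) - 1) * (\<Sum>i<L. measure (?law i) (far i)) \<le> (99 / 1000 * \<kappa>) * L" by simp
    have bad: "far i = {} \<or> far i = UNIV" if "i < L" "i \<notin> good" for i using that by (simp add: far_def)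
    have "prob {\<omega>\<in>?E. 1 / 10 * (\<kappa> * N) \<le> 1 / 10 * count K far \<omega>}
        \<le> prob ?E * exp (N * (99 / 1000 * \<kappa>) - 1 / 10 * (\<kappa> * N))"
      unfolding count_def e(1) by (rule prob_block_count[OF a e(2,3) visited far_sets bad sum])
    also have "N * (99 / 1000 * \<kappa>) - 1 / 10 * (\<kappa> * N) = - (\<kappa> * N / 1000)" by simp
    finally show ?thesis by simp
  qed
  have only_sets: "only B i \<in> sets borel" if "B \<in> sets borel" for B i using that by (simp add: only_def)
  have only_bad: "only B i = {} \<or> only B i = UNIV" if "i < L" "i \<notin> good" for B i using that by (simp add: only_def)
  \<comment> \<open>The cut points have level \<open>3 / 2 * \<kappa>\<close>, strictly between two
    thresholds: for the open half-lines the count in the first half should stay below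
    \<open>3 * \<kappa> * N\<close>, and for the closed ones, in \<open>many\<close>, the count in
    the second half should exceed \<open>\<kappa> * N\<close>.\<close>
  have few: "prob {\<omega>\<in>?E. 3 * \<kappa> * N \<le> count S1 (only B) \<omega>} \<le> prob ?E * ?e"
    if B: "B \<in> sets borel" "(\<Sum>i\<in>good. measure (?law i) B) \<le> q" for B
  proof -
    have "(exp (1 / 10) - 1) * (\<Sum>i<L. measure (?law i) (only B i)) \<le> 11 / 100 * (3 / 2 * \<kappa> * L)"
      using exps B(2) unfolding only_def sum_good q_def by (intro mult_mono) (auto intro: sum_nonneg)
    then have sum: "(exp (1 / 10) - 1) * (\<Sum>i<L. measure (?law i) (only B i)) \<le> (33 / 200 * \<kappa>) * L" by simp
    have "prob {\<omega>\<in>?E. 1 / 10 * (3 * \<kappa> * N) \<le> 1 / 10 * count S1 (only B) \<omega>}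
        \<le> prob ?E * exp (N * (33 / 200 * \<kappa>) - 1 / 10 * (3 * \<kappa> * N))"
      unfolding count_def S1_def
      by (rule prob_block_count[OF a blk(1,2) visited only_sets[OF B(1)] only_bad sum])
    also have "\<dots> \<le> prob ?E * ?e" using \<kappa>N by (intro mult_left_mono) auto
    finally show ?thesis by (simp add: mult.assoc)
  qed
  have many: "prob {\<omega>\<in>?E. count S2 (only B) \<omega> \<le> \<kappa> * N} \<le> prob ?E * ?e"
    if B: "B \<in> sets borel" "q \<le> (\<Sum>i\<in>good. measure (?law i) B)" for B
  proof -
    have "(exp (- (1 / 10)) - 1) * (\<Sum>i<L. measure (?law i) (only B i)) \<le> (- 9 / 100) * (3 / 2 * \<kappa> * L)"
    proof -
      have "9 / 100 * (3 / 2 * \<kappa> * L) \<le> (1 - exp (- (1 / 10))) * (\<Sum>i<L. measure (?law i) (only B i))"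
        using exps B(2) \<kappa>N unfolding only_def sum_good q_def by (intro mult_mono) auto
      then show ?thesis by (simp add: algebra_simps)
    qed
    then have sum: "(exp (- (1 / 10)) - 1) * (\<Sum>i<L. measure (?law i) (only B i)) \<le> (- 27 / 200 * \<kappa>) * L" by simp
    have "prob {\<omega>\<in>?E. - (1 / 10) * (\<kappa> * N) \<le> - (1 / 10) * count S2 (only B) \<omega>}
        \<le> prob ?E * exp (N * (- 27 / 200 * \<kappa>) - - (1 / 10) * (\<kappa> * N))"
      unfolding count_def S2_def
      by (rule prob_block_count[OF a blk(3,4) visited only_sets[OF B(1)] only_bad sum])
    also have "\<dots> \<le> prob ?E * ?e" using \<kappa>N by (intro mult_left_mono) auto
    finally show ?thesis by simp
  qed
  have mid_meas: "mid \<tau> i \<in> borel_measurable borel" for \<tau> i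
    unfolding mid_def clip_def by simp
  have centre: "prob {\<omega>\<in>?E. \<kappa> * N \<le> total \<tau> \<omega>} \<le> prob ?E * ?e" if \<tau>: "\<bar>\<tau>\<bar> = 1" for \<tau>
  proof -
    have vs: "2 * v / s\<^sup>2 = \<kappa> / 5" using s by (simp add: field_simps)
    have g: "(\<integral>\<^sup>+y. ennreal (exp (mid \<tau> i y)) \<partial>?law i) \<le> ennreal (1 + \<kappa> / 5)" if "i \<in> good" for i
      using real_distribution.nn_integral_exp_clip_le[OF law s(1) \<tau> mean_law_moments(1,3,4,2)[OF a visits], of i] that good(2)
      by (auto simp: mid_def vs)
    have "prob {\<omega>\<in>?E. \<kappa> * N \<le> total \<tau> \<omega>} \<le> prob ?E * exp (N * (\<kappa> / 5) - \<kappa> * N)"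
      unfolding total_def S1_def
      by (rule prob_block_sum[OF a blk(1,2) visited mid_meas _ g])
         (use \<kappa> in \<open>auto simp: mid_def\<close>)
    also have "\<dots> \<le> prob ?E * ?e" using \<kappa>N by (intro mult_left_mono) auto
    finally show ?thesis .
  qed

  \<comment> \<open>Measurability of the exceptional events\<close>
  have count_meas: "count K B \<in> borel_measurable M" if "\<And>i. B i \<in> sets borel" "finite K" for K B
  proof -
    have eq: "count K B = (\<lambda>\<omega>. \<Sum>k\<in>K. indicator (B (seed \<omega> ! k)) (emp_mean T (seed \<omega> ! k) \<omega>))"
      using that(2) by (intro ext) (simp add: count_def indicator_def sum.If_cases Int_def)
    show ?thesis
      unfolding eq by (rule block_sum_measurable[where \<phi>="\<lambda>i. indicator (B i)"]) (use that in simp)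
  qed
  have total_meas: "total \<tau> \<in> borel_measurable M" for \<tau>
    unfolding total_def using block_sum_measurable[OF mid_meas] .
  have fin: "finite S1" "finite S2" by (auto simp: S1_def S2_def)
  have E_sub: "?E \<subseteq> space M" by (auto simp: arrival_event_def)
  have ev: "{\<omega>\<in>?E. c \<le> f \<omega>} \<in> sets M" "{\<omega>\<in>?E. f \<omega> \<le> c} \<in> sets M"
    if "f \<in> borel_measurable M" for f :: "'a \<Rightarrow> real" and c
  proof -
    have "{\<omega>\<in>?E. c \<le> f \<omega>} = ?E \<inter> {\<omega>\<in>space M. c \<le> f \<omega>}" "{\<omega>\<in>?E. f \<omega> \<le> c} = ?E \<inter> {\<omega>\<in>space M. f \<omega> \<le> c}"
      using E_sub by auto
    moreover have "{\<omega>\<in>space M. c \<le> f \<omega>} \<in> sets M" "{\<omega>\<in>space M. f \<omega> \<le> c} \<in> sets M"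
      using that by measurable
    ultimately show "{\<omega>\<in>?E. c \<le> f \<omega>} \<in> sets M" "{\<omega>\<in>?E. f \<omega> \<le> c} \<in> sets M" by simp_all
  qed

  \<comment> \<open>Collecting the eight events in a list allows one union bound, with measurability
    and probability checked for all entries at once.\<close>
  define U where "U = [{\<omega>\<in>?E. \<kappa> * N \<le> count S1 far \<omega>}, {\<omega>\<in>?E. \<kappa> * N \<le> count S2 far \<omega>},
    {\<omega>\<in>?E. 3 * \<kappa> * N \<le> count S1 (only {..<q1}) \<omega>}, {\<omega>\<in>?E. 3 * \<kappa> * N \<le> count S1 (only {q2<..}) \<omega>},
    {\<omega>\<in>?E. count S2 (only {..q1}) \<omega> \<le> \<kappa> * N}, {\<omega>\<in>?E. count S2 (only {q2..}) \<omega> \<le> \<kappa> * N},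
    {\<omega>\<in>?E. \<kappa> * N \<le> total 1 \<omega>}, {\<omega>\<in>?E. \<kappa> * N \<le> total (- 1) \<omega>}]"
  have len8: "length U = 8" by (simp add: U_def)
  have U_sets: "U ! n \<in> sets M" if "n < 8" for n
  proof -
    have "\<forall>X\<in>set U. X \<in> sets M"
      unfolding U_def
      by (simp add: ev count_meas[OF far_sets] count_meas[OF only_sets] total_meas fin)
    then show ?thesis using that by (simp add: len8)
  qed
  have U_prob: "prob (U ! n) \<le> prob ?E * ?e" if "n < 8" for n
  proof -
    have "\<forall>X\<in>set U. prob X \<le> prob ?E * ?e"
      unfolding U_def using far_prob few[OF _ q1(1)] few[OF _ q2(1)] many[OF _ q1(2)] many[OF _ q2(2)]
        centre[of 1] centre[of "- 1"] by simp
    then show ?thesis using that by (simp add: len8)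
  qed
  have "{\<omega>\<in>?E. \<not> \<bar>arm_estimate L A \<alpha> seed user rew T a \<omega> - \<mu> a\<bar> \<le> 14 * s * \<kappa>} \<subseteq> (\<Union>n<8. U ! n)"
  proof (intro subsetI, rule ccontr)
    fix \<omega> assume \<omega>: "\<omega> \<in> {\<omega>\<in>?E. \<not> \<bar>arm_estimate L A \<alpha> seed user rew T a \<omega> - \<mu> a\<bar> \<le> 14 * s * \<kappa>}"
      and "\<omega> \<notin> (\<Union>n<8. U ! n)"
    then have "\<omega> \<in> ?E" "\<forall>X\<in>set U. \<omega> \<notin> X"
      by (auto simp: in_set_conv_nth len8)
    then have c: "count S1 far \<omega> < \<kappa> * N" "count S2 far \<omega> < \<kappa> * N"
      "count S1 (only {..<q1}) \<omega> \<le> 3 * \<kappa> * N" "count S1 (only {q2<..}) \<omega> \<le> 3 * \<kappa> * N"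
      "\<kappa> * N < count S2 (only {..q1}) \<omega>" "\<kappa> * N < count S2 (only {q2..}) \<omega>"
      "total 1 \<omega> \<le> \<kappa> * N" "total (- 1) \<omega> \<le> \<kappa> * N"
      by (auto simp: U_def not_le)
    have p: "seed \<omega> \<in> permutations_of_set {..<L}" using \<open>\<omega> \<in> ?E\<close> E_sub seed_permutation by auto
    define zs where "zs = map (\<lambda>i. emp_mean T i \<omega>) (user_group L A (seed \<omega>) a)"
    have len: "length zs = Suc a * L div A - d" by (simp add: zs_def length_user_group[OF p a] d_def)
    then have NN: "length zs div 2 = N" by (simp add: N d_def)
    \<comment> \<open>Position \<open>k\<close> of the group is position \<open>d + k\<close> of the
      seed, so \<open>{0..<N}\<close> and \<open>{N..<N + N}\<close> correspond to \<open>S1\<close>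
      and \<open>S2\<close>.\<close>
    have zs: "zs ! k = emp_mean T (seed \<omega> ! (d + k)) \<omega>" if "k < length zs" for k
      using that len nth_user_group[OF p a, of k] by (simp add: zs_def d_def)
    have segment: "real (card {k\<in>{x..<x + N}. zs ! k \<in> B (seed \<omega> ! (d + k))}) = count {d + x..<d + x + N} B \<omega>"
      if "x + N \<le> length zs" for x B
    proof -
      have "{k\<in>{x..<x + N}. zs ! k \<in> B (seed \<omega> ! (d + k))}
          = {k\<in>{x..<x + N}. emp_mean T (seed \<omega> ! (d + k)) \<omega> \<in> B (seed \<omega> ! (d + k))}"
        using that by (auto simp: zs)
      then show ?thesis using card_shift_segment[of x N "\<lambda>k. emp_mean T (seed \<omega> ! k) \<omega> \<in> B (seed \<omega> ! k)" d]
        by (simp add: count_def)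
    qed
    have count1: "real (card {k\<in>{0..<N}. zs ! k \<in> B (seed \<omega> ! (d + k))}) = count S1 B \<omega>"
      and count2: "real (card {k\<in>{N..<N + N}. zs ! k \<in> B (seed \<omega> ! (d + k))}) = count S2 B \<omega>" for B
      using segment[of 0] segment[of N] NN by (auto simp: S1_def S2_def)
    have far_iff: "y \<in> far i \<longleftrightarrow> i \<notin> good \<or> s < \<bar>y - \<mu> a\<bar>"
      and only_iff: "y \<in> only B i \<longleftrightarrow> \<not> i \<notin> good \<and> y \<in> B" for y i B
      by (auto simp: far_def only_def)
    \<comment> \<open>The two totals are \<open>Q / s\<close> and \<open>- Q / s\<close>, so their
      one-sided bounds together control the absolute value of \<open>Q\<close>.\<close>
    define Q where "Q = (\<Sum>k\<in>{0..<N}. if seed \<omega> ! (d + k) \<notin> good then 0 else clip (- s) s (zs ! k - \<mu> a))"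
    have tot: "total \<tau> \<omega> = \<tau> * Q / s" for \<tau>
    proof -
      have "total \<tau> \<omega> = (\<Sum>k\<in>{0..<N}. mid \<tau> (seed \<omega> ! (d + k)) (emp_mean T (seed \<omega> ! (d + k)) \<omega>))"
        unfolding total_def S1_def
        by (rule sum.reindex_bij_witness[of _ "\<lambda>k. d + k" "\<lambda>k. k - d"]) auto
      also have "\<dots> = (\<Sum>k\<in>{0..<N}. \<tau> / s * (if seed \<omega> ! (d + k) \<notin> good then 0 else clip (- s) s (zs ! k - \<mu> a)))"
        using NN by (intro sum.cong refl) (auto simp: mid_def zs)
      also have "\<dots> = \<tau> / s * (\<Sum>k\<in>{0..<N}. if seed \<omega> ! (d + k) \<notin> good then 0 else clip (- s) s (zs ! k - \<mu> a))"
        by (rule sum_distrib_left[symmetric])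
      finally show ?thesis by (simp only: times_divide_eq_left Q_def)
    qed
    have "Q / s \<le> \<kappa> * N" "(- Q) / s \<le> \<kappa> * N" using c(7,8) by (simp_all add: tot)
    then have "Q \<le> \<kappa> * N * s" "- Q \<le> \<kappa> * N * s" by (simp_all only: pos_divide_le_eq[OF s(1)])
    then have Q: "\<bar>Q\<bar> \<le> \<kappa> * N * s" by (rule abs_leI)
    have "\<bar>trimmed_mean \<alpha> (1 / (10 * real A)) zs - \<mu> a\<bar> \<le> 14 * s * \<kappa>"
    proof (rule trimmed_mean_deviation[where zs=zs and bad="\<lambda>k. seed \<omega> ! (d + k) \<notin> good" and ?q1.0=q1 and ?q2.0=q2, unfolded NN])
      show "card {k\<in>{N..<N + N}. seed \<omega> ! (d + k) \<notin> good \<or> s < \<bar>zs ! k - \<mu> a\<bar>} < \<kappa> * N"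
        using c(2) by (simp only: count2[of far, unfolded far_iff])
      show "card {k\<in>{0..<N}. seed \<omega> ! (d + k) \<notin> good \<or> s < \<bar>zs ! k - \<mu> a\<bar>} < \<kappa> * N"
        using c(1) by (simp only: count1[of far, unfolded far_iff])
      show "\<kappa> * N < card {k\<in>{N..<N + N}. \<not> seed \<omega> ! (d + k) \<notin> good \<and> zs ! k \<le> q1}"
        using c(5) by (simp only: count2[of "only {..q1}", unfolded only_iff atMost_iff])
      show "\<kappa> * N < card {k\<in>{N..<N + N}. \<not> seed \<omega> ! (d + k) \<notin> good \<and> q2 \<le> zs ! k}"
        using c(6) by (simp only: count2[of "only {q2..}", unfolded only_iff atLeast_iff])
      show "card {k\<in>{0..<N}. \<not> seed \<omega> ! (d + k) \<notin> good \<and> zs ! k < q1} \<le> 3 * \<kappa> * N"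
        using c(3) by (simp only: count1[of "only {..<q1}", unfolded only_iff lessThan_iff])
      show "card {k\<in>{0..<N}. \<not> seed \<omega> ! (d + k) \<notin> good \<and> q2 < zs ! k} \<le> 3 * \<kappa> * N"
        using c(4) by (simp only: count1[of "only {q2<..}", unfolded only_iff greaterThan_iff])
      show "\<bar>\<Sum>k\<in>{0..<N}. if seed \<omega> ! (d + k) \<notin> good then 0 else clip (- s) s (zs ! k - \<mu> a)\<bar> \<le> s * \<kappa> * N"
        unfolding Q_def[symmetric] using Q by (simp add: mult.assoc mult.commute[of s])
    qed (use \<kappa> N s in auto)
    then show False using \<omega> by (simp add: arm_estimate_def zs_def)
  qed
  then have "prob {\<omega>\<in>?E. \<not> \<bar>arm_estimate L A \<alpha> seed user rew T a \<omega> - \<mu> a\<bar> \<le> 14 * s * \<kappa>} \<le> prob (\<Union>n<8. U ! n)"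
    using U_sets by (intro finite_measure_mono) auto
  also have "\<dots> \<le> (\<Sum>n<8. prob (U ! n))"
    using U_sets by (intro finite_measure_subadditive_finite) auto
  also have "\<dots> \<le> (\<Sum>n<(8::nat). prob ?E * ?e)" using U_prob by (intro sum_mono) auto
  finally show ?thesis by (simp add: mult_ac)
qed

end

section \<open>All arms\<close>

lemma trim_level_pos:
  assumes "0 < \<alpha>" "0 < A"
  shows "0 < trim_level \<alpha> (1 / (10 * real A)) N"
proof -
  have "0 \<le> ln (4 / (1 / (10 * real A)))" using assms by simp
  then have "0 \<le> 12 * ln (4 / (1 / (10 * real A))) / real N" by (intro divide_nonneg_nonneg) auto
  then have "0 < 8 * \<alpha> + 12 * ln (4 / (1 / (10 * real A))) / real N" using assms by (intro add_pos_nonneg) auto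
  then show ?thesis unfolding trim_level_def by (simp only: min_less_iff_conj) simp
qed

text \<open>
  The factor 128 covers both the \<open>4 / \<delta> = 40 A\<close> of the trimming level and the \<open>80 A\<close> needed to push 8
  failure probabilities below \<open>1 / (10 A)\<close>.
\<close>

lemma ln_confidence_le:
  fixes A :: nat
  assumes "0 < A"
  shows "ln (128 * real A) \<le> 8 * max 1 (log 2 (real A))"
proof -
  define m where "m = max 1 (log 2 (real A))"
  have m: "1 \<le> m" "log 2 (real A) \<le> m" by (auto simp: m_def)
  have ln2: "ln 2 \<le> (1 :: real)" using ln_le_minus_one[of "2 :: real"] by simp
  have "ln (128 * real A) = ln (2 ^ 7) + ln (real A)" using assms by (simp add: ln_mult)
  also have "ln ((2 :: real) ^ 7) = 7 * ln 2" by (subst ln_realpow) auto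
  also have "ln (real A) = log 2 (real A) * ln 2" by (simp add: log_def)
  also have "7 * ln 2 + log 2 (real A) * ln 2 \<le> 7 * m * 1 + m * 1"
    using m ln2 assms by (intro add_mono mult_mono) auto
  finally show ?thesis by (simp add: m_def)
qed

context grouped_bandit
begin

lemma arm_estimate_measurable:
  assumes "0 < \<alpha>"
  shows "(\<lambda>\<omega>. arm_estimate L A \<alpha> seed user rew T a \<omega>) \<in> borel_measurable M"
  unfolding arm_estimate_def
  by (rule seed_compose_measurable, rule trimmed_mean_measurable[OF user_mean_measurable])
     (intro less_imp_le trim_level_pos assms A_pos)

section \<open>Numbers of visits and sizes of groups\<close>

lemma sum_visits:
  assumes "\<omega> \<in> space M"
  shows "(\<Sum>j<L. visits user j T \<omega>) = T"
proof -
  have "(\<Sum>j<L. visits user j T \<omega>) = card (\<Union>j<L. {s. s < T \<and> user s \<omega> = j})"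
    unfolding visits_def by (intro card_UN_disjoint[symmetric]) auto
  also have "(\<Union>j<L. {s. s < T \<and> user s \<omega> = j}) = {..<T}" using user_less[OF assms] by auto
  finally show ?thesis by simp
qed

text \<open>Sum \<open>arrivals_balanced\<close> over all users \<open>j\<close>, whose visits add
  up to \<open>T\<close>. For positive \<open>c\<^sub>L\<close> every user thus has at least
  \<open>T / (L * c\<^sub>L)\<close> visits.\<close>

lemma visits_lower:
  assumes "\<omega> \<in> space M" "L \<le> T" "i < L"
  shows "real T \<le> real L * c\<^sub>L * real (visits user i T \<omega>)"
proof -
  have "real T = (\<Sum>j<L. real (visits user j T \<omega>))"
    using sum_visits[OF assms(1), of T] by (metis of_nat_sum)
  also have "\<dots> \<le> (\<Sum>j<L. c\<^sub>L * real (visits user i T \<omega>))"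
    using assms by (intro sum_mono arrivals_balanced) auto
  finally show ?thesis by simp
qed

text \<open>A block has at least \<open>L div A\<close> users, and the roundings give
  \<open>L / A \<le> 2 * (n div 2) + 2\<close> for a block of size \<open>n\<close>; from
  \<open>L / A = 4\<close> on the additive loss costs at most a factor 2.\<close>

lemma half_group_size:
  assumes "4 \<le> real L / real A"
  shows "real L / (4 * real A) \<le> real ((Suc a * L div A - a * L div A) div 2)"
proof -
  define n where "n = Suc a * L div A - a * L div A"
  have "a * L div A + L div A \<le> Suc a * L div A"
    using div_add1_eq[of "a * L" L A] by (simp add: add.commute)
  then have "L div A \<le> n" unfolding n_def by linarith
  moreover have "real L / real A < real (L div A) + 1"
    using floor_divide_of_nat_eq[of L A, where ?'a=real] by linarith
  moreover have "real n \<le> 2 * real (n div 2) + 1" by linarith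
  ultimately have "real L / real A \<le> 2 * real (n div 2) + 2" by linarith
  moreover have "real L / (4 * real A) = (real L / real A) / 4" by simp
  ultimately show ?thesis using assms unfolding n_def[symmetric] by linarith
qed

text \<open>Distinct extensional paths differ at some step before \<open>T\<close>, so their events
  are disjoint. Extensionality lists every path of length \<open>T\<close> only once.\<close>

lemma sum_prob_arrival_event: "(\<Sum>w\<in>{..<T} \<rightarrow>\<^sub>E {..<L}. prob (arrival_event T w)) \<le> 1"
proof -
  have "disjoint_family_on (arrival_event T) ({..<T} \<rightarrow>\<^sub>E {..<L})"
    unfolding disjoint_family_on_def
  proof (intro ballI impI)
    fix w w' assume w: "w \<in> {..<T} \<rightarrow>\<^sub>E {..<L}" "w' \<in> {..<T} \<rightarrow>\<^sub>E {..<L}" "w \<noteq> w'"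
    then obtain t where "t < T" "w t \<noteq> w' t" by (metis PiE_ext lessThan_iff)
    then show "arrival_event T w \<inter> arrival_event T w' = {}" by (auto simp: arrival_event_def)
  qed
  then have "prob (\<Union>w\<in>{..<T} \<rightarrow>\<^sub>E {..<L}. arrival_event T w) = (\<Sum>w\<in>{..<T} \<rightarrow>\<^sub>E {..<L}. prob (arrival_event T w))"
    using arrival_event_sets by (intro finite_measure_finite_Union) (blast intro: finite_PiE)+
  from this[symmetric] prob_le_1 show ?thesis by (rule ord_eq_le_trans)
qed

text \<open>Only the choice of parameters remains. By \<open>visits_lower\<close>,
  \<open>v = c * L / T\<close> bounds the variance of each \<open>mean_law\<close>. The constant
  \<open>17640 = 14 * 14 * 10 * 9\<close> comes from the error \<open>14 * s * \<kappa>\<close>, the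
  relation \<open>s\<^sup>2 * \<kappa> = 10 * v\<close> and
  \<open>\<kappa> \<le> 9 * \<alpha>\<close>. The constant 40000 gives
  \<open>\<alpha> * N \<ge> 10000 * m\<close>, so that \<open>\<kappa> * N / 1000\<close> reaches
  \<open>ln (128 * real A)\<close>.\<close>

lemma arm_failure_prob:
  fixes \<epsilon> :: real
  assumes \<epsilon>: "0 < \<epsilon>" "\<epsilon> < \<alpha>" and \<alpha>: "\<alpha> < 1 / 3"
    and L: "real L \<ge> 40000 * (real A * max 1 (log 2 (real A)) / \<alpha>)"
    and T: "real T / real L \<ge> 17640 * max 1 c\<^sub>L * (\<alpha> / \<epsilon>\<^sup>2)"
    and a: "a < A"
  shows "prob {\<omega>\<in>space M. \<not> \<bar>arm_estimate L A \<alpha> seed user rew T a \<omega> - \<mu> a\<bar> \<le> \<epsilon>} \<le> 1 / (10 * real A)"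
proof -
  define m where "m = max 1 (log 2 (real A))"
  define c where "c = max 1 c\<^sub>L"
  define N where "N = (Suc a * L div A - a * L div A) div 2"
  define \<kappa> where "\<kappa> = trim_level \<alpha> (1 / (10 * real A)) N"
  define v where "v = c * real L / real T"
  define s where "s = sqrt (10 * v / \<kappa>)"
  have m: "1 \<le> m" by (simp add: m_def)
  have c: "1 \<le> c" "c\<^sub>L \<le> c" by (auto simp: c_def)
  have \<alpha>0: "0 < \<alpha>" using \<epsilon> by linarith
  have A: "0 < real A" and L0: "0 < real L" using A_pos L_pos by auto
  have \<alpha>L: "40000 * m \<le> \<alpha> * (real L / real A)"
    using L \<alpha>0 A by (simp add: m_def[symmetric] field_simps)
  have "40000 \<le> \<alpha> * (real L / real A)" using \<alpha>L m by linarith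
  also have "\<alpha> * (real L / real A) \<le> 1 * (real L / real A)"
    using \<alpha> A by (intro mult_right_mono) auto
  finally have LA: "4 \<le> real L / real A" by simp
  have N4: "real L / (4 * real A) \<le> real N"
    unfolding N_def by (rule half_group_size[OF LA])
  have \<alpha>N: "10000 * m \<le> \<alpha> * real N"
  proof -
    have "10000 * m \<le> \<alpha> * (real L / (4 * real A))" using \<alpha>L by simp
    also have "\<dots> \<le> \<alpha> * real N" using \<alpha>0 N4 by (intro mult_left_mono) auto
    finally show ?thesis .
  qed
  then have N0: "0 < N" using m by (cases "N = 0") auto
  have ln: "ln (128 * real A) \<le> 8 * m" unfolding m_def by (rule ln_confidence_le[OF A_pos])
  have \<kappa>0: "0 < \<kappa>" unfolding \<kappa>_def by (rule trim_level_pos[OF \<alpha>0 A_pos])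
  have conf: "4 / (1 / (10 * real A)) = 40 * real A" by simp
  have "0 \<le> ln (40 * real A)" "ln (40 * real A) \<le> ln (128 * real A)" using A_pos by auto
  then have t: "0 \<le> 12 * ln (40 * real A) / real N" "12 * ln (40 * real A) / real N \<le> \<alpha>"
    using ln \<alpha>N m N0 by (simp, simp add: pos_divide_le_eq)
  \<comment> \<open>If the cap is active, \<open>4 / 5 * \<kappa>\<close> is \<open>1 / 3\<close>,
    which exceeds \<open>\<alpha>\<close>; otherwise \<open>\<kappa>\<close> is at least
    \<open>8 * \<alpha>\<close>. The upper bound holds because the confidence term is at most
    \<open>\<alpha>\<close>.\<close>
  have \<kappa>: "\<alpha> \<le> 4 / 5 * \<kappa>" "\<kappa> \<le> 9 * \<alpha>"
    using t \<alpha> \<alpha>0 unfolding \<kappa>_def trim_level_def conf by (auto simp: min_def)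

  \<comment> \<open>Balance of arrivals is assumed only from step \<open>L\<close> on; this estimate
    turns the bound on \<open>T / L\<close> into \<open>L \<le> T\<close>.\<close>
  have \<epsilon>2: "\<epsilon>\<^sup>2 \<le> \<alpha>"
  proof -
    have "\<epsilon>\<^sup>2 \<le> \<epsilon> * 1" unfolding power2_eq_square using \<epsilon> \<alpha> by (intro mult_left_mono) auto
    then show ?thesis using \<epsilon> by simp
  qed
  have T': "17640 * c * \<alpha> * real L \<le> \<epsilon>\<^sup>2 * real T"
    using T \<epsilon>(1) L0 by (simp add: c_def[symmetric] field_simps)
  have "1 * \<alpha> * real L \<le> 17640 * c * \<alpha> * real L"
    using c \<alpha>0 L0 by (intro mult_right_mono) auto
  also note T'
  also have "\<epsilon>\<^sup>2 * real T \<le> \<alpha> * real T" using \<epsilon>2 by (intro mult_right_mono) auto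
  finally have LT: "L \<le> T" using \<alpha>0 by simp
  then have T0: "0 < real T" using L_pos by simp
  have v0: "0 < v" using c L0 T0 by (simp add: v_def)
  have s: "0 < s" "s\<^sup>2 * \<kappa> = 10 * v" using v0 \<kappa>0 by (auto simp: s_def)
  have "(14 * s * \<kappa>)\<^sup>2 = 1960 * v * \<kappa>"
    using s(2) by (simp add: power_mult_distrib power2_eq_square algebra_simps)
  also have "\<dots> \<le> 1960 * v * (9 * \<alpha>)" using \<kappa>(2) v0 by (intro mult_left_mono) auto
  also have "\<dots> \<le> \<epsilon>\<^sup>2" using T' T0 by (simp add: v_def field_simps)
  finally have eps: "14 * s * \<kappa> \<le> \<epsilon>" by (rule power2_le_imp_le) (use \<epsilon> in simp)

  have "10 * m \<le> \<kappa> * real N / 1000"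
  proof -
    have "\<alpha> * real N \<le> \<kappa> * real N" using \<kappa>(1) \<kappa>0 by (intro mult_right_mono) auto
    then show ?thesis using \<alpha>N by simp
  qed
  then have "ln (128 * real A) \<le> \<kappa> * real N / 1000" using ln m by linarith
  then have "exp (- (\<kappa> * real N / 1000)) \<le> exp (- ln (128 * real A))" by simp
  also have "\<dots> = 1 / (128 * real A)" using A by (simp add: exp_minus exp_ln inverse_eq_divide)
  finally have fail: "8 * exp (- (\<kappa> * real N / 1000)) \<le> 1 / (10 * real A)"
    using A by (simp add: field_simps)

  \<comment> \<open>There are finitely many arrival paths of length \<open>T\<close>, and the
    failure probability on each is the probability of the path times one common factor.\<close>
  let ?W = "{..<T} \<rightarrow>\<^sub>E {..<L}"
  define F where "F w = {\<omega>\<in>arrival_event T w. \<not> \<bar>arm_estimate L A \<alpha> seed user rew T a \<omega> - \<mu> a\<bar> \<le> 14 * s * \<kappa>}" for w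
  have F: "prob (F w) \<le> prob (arrival_event T w) * (8 * exp (- (\<kappa> * real N / 1000)))" for w
  \<comment> \<open>Balance is a statement about outcomes, so it constrains \<open>w\<close> only if
    some outcome follows this path; otherwise the bound is trivial.\<close>
  proof (cases "arrival_event T w = {}")
    case False
    then obtain \<omega> where \<omega>: "\<omega> \<in> space M" "\<And>t. t < T \<Longrightarrow> user t \<omega> = w t" by (auto simp: arrival_event_def)
    have "1 \<le> v * card {t. t < T \<and> w t = i}" if "i < L" for i
    proof -
      have "{t. t < T \<and> w t = i} = {t. t < T \<and> user t \<omega> = i}" using \<omega>(2) by auto
      then have "real T \<le> real L * c\<^sub>L * real (card {t. t < T \<and> w t = i})"
        using visits_lower[OF \<omega>(1) LT that] by (simp add: visits_def)
      also have "\<dots> \<le> real L * c * real (card {t. t < T \<and> w t = i})"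
        using c by (intro mult_right_mono mult_left_mono) auto
      finally show ?thesis using T0 by (simp add: v_def field_simps)
    qed
    then show ?thesis
      unfolding F_def by (rule arm_estimate_deviation[OF a \<alpha> N_def N0 \<kappa>_def \<kappa>0 \<kappa>(1) s])
  qed (simp add: F_def)
  have F_sets: "F w \<in> sets M" for w
  proof -
    note [measurable] = arm_estimate_measurable[OF \<alpha>0, of T a]
    have "F w = arrival_event T w \<inter> {\<omega>\<in>space M. \<not> \<bar>arm_estimate L A \<alpha> seed user rew T a \<omega> - \<mu> a\<bar> \<le> 14 * s * \<kappa>}"
      by (auto simp: F_def arrival_event_def)
    moreover have "{\<omega>\<in>space M. \<not> \<bar>arm_estimate L A \<alpha> seed user rew T a \<omega> - \<mu> a\<bar> \<le> 14 * s * \<kappa>} \<in> sets M"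
      by measurable
    ultimately show ?thesis by simp
  qed
  have "{\<omega>\<in>space M. \<not> \<bar>arm_estimate L A \<alpha> seed user rew T a \<omega> - \<mu> a\<bar> \<le> \<epsilon>} \<subseteq> (\<Union>w\<in>?W. F w)"
  proof
    fix \<omega> assume "\<omega> \<in> {\<omega>\<in>space M. \<not> \<bar>arm_estimate L A \<alpha> seed user rew T a \<omega> - \<mu> a\<bar> \<le> \<epsilon>}"
    then have \<omega>: "\<omega> \<in> space M" "\<not> \<bar>arm_estimate L A \<alpha> seed user rew T a \<omega> - \<mu> a\<bar> \<le> 14 * s * \<kappa>"
      using eps by auto
    then have "\<omega> \<in> F (\<lambda>t\<in>{..<T}. user t \<omega>)" by (simp add: F_def arrival_event_def)
    moreover have "(\<lambda>t\<in>{..<T}. user t \<omega>) \<in> ?W" using user_less[OF \<omega>(1)] by auto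
    ultimately show "\<omega> \<in> (\<Union>w\<in>?W. F w)" by blast
  qed
  then have "prob {\<omega>\<in>space M. \<not> \<bar>arm_estimate L A \<alpha> seed user rew T a \<omega> - \<mu> a\<bar> \<le> \<epsilon>} \<le> prob (\<Union>w\<in>?W. F w)"
    using F_sets by (intro finite_measure_mono sets.finite_UN finite_PiE) auto
  also have "\<dots> \<le> (\<Sum>w\<in>?W. prob (F w))"
    using F_sets by (intro finite_measure_subadditive_finite finite_PiE) auto
  also have "\<dots> \<le> (\<Sum>w\<in>?W. prob (arrival_event T w) * (8 * exp (- (\<kappa> * real N / 1000))))"
    by (intro sum_mono F)
  also have "\<dots> = (\<Sum>w\<in>?W. prob (arrival_event T w)) * (8 * exp (- (\<kappa> * real N / 1000)))"
    by (simp only: sum_distrib_right)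
  also have "\<dots> \<le> 1 * (8 * exp (- (\<kappa> * real N / 1000)))"
    by (intro mult_right_mono sum_prob_arrival_event) simp
  finally show ?thesis using fail by simp
qed

text \<open>A union bound over the \<open>A\<close> arms, each failing with probability at most
  \<open>1 / (10 * A)\<close>.\<close>

lemma uniform_accuracy:
  fixes \<epsilon> :: real
  assumes \<epsilon>: "0 < \<epsilon>" "\<epsilon> < \<alpha>" and \<alpha>: "\<alpha> < 1 / 3"
    and L: "real L \<ge> 40000 * (real A * max 1 (log 2 (real A)) / \<alpha>)"
    and T: "real T / real L \<ge> 17640 * max 1 c\<^sub>L * (\<alpha> / \<epsilon>\<^sup>2)"
  shows "9 / 10 \<le> prob {\<omega>\<in>space M. \<forall>a<A. \<bar>arm_estimate L A \<alpha> seed user rew T a \<omega> - \<mu> a\<bar> \<le> \<epsilon>}"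
proof -
  define F where "F a = {\<omega>\<in>space M. \<not> \<bar>arm_estimate L A \<alpha> seed user rew T a \<omega> - \<mu> a\<bar> \<le> \<epsilon>}" for a
  have F_sets: "F a \<in> sets M" for a
  proof -
    have [measurable]: "(\<lambda>\<omega>. arm_estimate L A \<alpha> seed user rew T a \<omega>) \<in> borel_measurable M"
      using \<epsilon> by (intro arm_estimate_measurable) simp
    show ?thesis unfolding F_def by measurable
  qed
  have "prob (\<Union>a<A. F a) \<le> (\<Sum>a<A. prob (F a))"
    using F_sets by (intro finite_measure_subadditive_finite) auto
  also have "\<dots> \<le> (\<Sum>a<A. 1 / (10 * real A))"
    unfolding F_def by (intro sum_mono arm_failure_prob[OF \<epsilon> \<alpha> L T]) auto
  also have "\<dots> = 1 / 10" using A_pos by simp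
  finally have "9 / 10 \<le> 1 - prob (\<Union>a<A. F a)" by simp
  also have "\<dots> = prob (space M - (\<Union>a<A. F a))"
    using F_sets by (intro prob_compl[symmetric]) auto
  also have "space M - (\<Union>a<A. F a) = {\<omega>\<in>space M. \<forall>a<A. \<bar>arm_estimate L A \<alpha> seed user rew T a \<omega> - \<mu> a\<bar> \<le> \<epsilon>}"
    by (auto simp: F_def)
  finally show ?thesis .
qed

end

theorem proposition3p1:
  fixes c\<^sub>L :: real
  shows "\<exists>C\<^sub>1>0. \<exists>C\<^sub>2>0.
    \<forall>(M :: run measure) (L :: nat) (A :: nat) (\<alpha> :: real) (\<epsilon> :: real) (good :: nat set)
      (R :: nat \<Rightarrow> real measure) (\<mu> :: nat \<Rightarrow> real) (seed :: run \<Rightarrow> nat list)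
      (user :: nat \<Rightarrow> run \<Rightarrow> nat) (act :: nat \<Rightarrow> run \<Rightarrow> nat) (rew :: nat \<Rightarrow> run \<Rightarrow> real) (T :: nat).
      A \<ge> 1 \<longrightarrow>
      0 < \<epsilon> \<longrightarrow> \<epsilon> < \<alpha> \<longrightarrow> \<alpha> < 1 / 3 \<longrightarrow>
      real L \<ge> C\<^sub>1 * (real A * max 1 (log 2 (real A)) / \<alpha>) \<longrightarrow>
      corrupted_bandit M L A \<alpha> c\<^sub>L good R \<mu> seed user act rew \<longrightarrow>
      random_grouping M L A seed user act \<longrightarrow>
      real T / real L \<ge> C\<^sub>2 * (\<alpha> / \<epsilon>\<^sup>2) \<longrightarrow>
      measure M {\<omega> \<in> space M. \<forall>a<A. \<bar>arm_estimate L A \<alpha> seed user rew T a \<omega> - \<mu> a\<bar> \<le> \<epsilon>} \<ge> 9 / 10"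
\<comment> \<open>The first constant is absolute. The second depends on \<open>c\<^sub>L\<close>
  alone, and \<open>max 1 c\<^sub>L\<close> keeps it positive for every real
  \<open>c\<^sub>L\<close>.\<close>
proof (rule exI[of _ 40000], rule conjI, simp, rule exI[of _ "17640 * max 1 c\<^sub>L"], rule conjI, simp, intro allI impI)
  fix M :: "run measure" and L A :: nat and \<alpha> \<epsilon> :: real and good :: "nat set"
    and R :: "nat \<Rightarrow> real measure" and \<mu> :: "nat \<Rightarrow> real" and seed :: "run \<Rightarrow> nat list"
    and user act :: "nat \<Rightarrow> run \<Rightarrow> nat" and rew :: "nat \<Rightarrow> run \<Rightarrow> real" and T :: nat
  assume A: "A \<ge> 1" and \<epsilon>: "0 < \<epsilon>" "\<epsilon> < \<alpha>" and \<alpha>: "\<alpha> < 1 / 3"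
    and L: "real L \<ge> 40000 * (real A * max 1 (log 2 (real A)) / \<alpha>)"
    and bandit: "corrupted_bandit M L A \<alpha> c\<^sub>L good R \<mu> seed user act rew"
    and grouping: "random_grouping M L A seed user act"
    and T: "real T / real L \<ge> 17640 * max 1 c\<^sub>L * (\<alpha> / \<epsilon>\<^sup>2)"
  interpret grouped_bandit M L A \<alpha> c\<^sub>L good R \<mu> seed user act rew
    using A by (intro grouped_bandit.intro bandit grouped_bandit_axioms.intro grouping) simp
  show "measure M {\<omega> \<in> space M. \<forall>a<A. \<bar>arm_estimate L A \<alpha> seed user rew T a \<omega> - \<mu> a\<bar> \<le> \<epsilon>} \<ge> 9 / 10"
    by (rule uniform_accuracy[OF \<epsilon> \<alpha> L T])
qed

end
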